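(* Fix $\epsilon\in(0,1)$, $\delta\in(0,\tfrac1e)$ and $B>0$. Let $C_1,C_2$ be such that \[ \frac{2\sqrt{C_2}}{C_1(\sqrt{C_2}-1)^2}\le\frac{\epsilon}{B^2} \] (e.g. $C_1=B^2$ and $C_2=\tfrac{14}{\epsilon^2}$). Let $A$ be an $(n\times d)$-matrix in which every row has $\ell_2$-norm at most $B$. Let $N$ be sampled from the $d$-dimensional Wishart distribution with $\nu$ degrees of freedom and scale matrix $V$, i.e. $N\sim\mathcal W_d(V,\nu)$, for any matrix $V$ with least singular value $\sigma_{\min}(V)\ge C_1$ (e.g. $V=C_1I_{d\times d}$) and $\nu\ge\lfloor d+2C_2\ln(4/\delta)\rfloor$. Then the algorithm outputting $X=A^{\top}A+N$ is $(\epsilon,\delta)$-differentially private.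
   Context: The Wishart distribution $\mathcal W_d(V,m)$ (for positive definite $V$) is the distribution of $\sum_{i=1}^m\mathbf g_i\mathbf g_i^{\top}$ with $\mathbf g_1,\dots,\mathbf g_m$ i.i.d. $\mathcal N(\mathbf 0_d,V)$. Two $(n\times d)$-matrices are neighbors if they differ in exactly one row. A randomized algorithm on $(n\times d)$-matrices with rows of $\ell_2$-norm at most $B$ is $(\epsilon,\delta)$-differentially private if for all neighboring such inputs $A,A'$ and every measurable set $S$ of outputs, $\Pr[\mathsf{ALG}(A)\in S]\le e^{\epsilon}\Pr[\mathsf{ALG}(A')\in S]+\delta$.
   Formalization: The formal theorem additionally assumes C_1>0 and C_2>1, without which the claim fails (e.g. d=n=1, B=C_1=V=ν=1, C_2=0.01, ε=1/2, δ=0.3); V is taken positive definite as in the context, and the example values of C_1, C_2 and V are not stated. *)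

theory Defs
  imports "HOL-Probability.Probability"
begin

definition pos_def_mat :: "real^'d^'d \<Rightarrow> bool" where
  "pos_def_mat V \<longleftrightarrow> transpose V = V \<and> (\<forall>x. x \<noteq> 0 \<longrightarrow> x \<bullet> (V *v x) > 0)"

definition least_singular_value :: "real^'d^'d \<Rightarrow> real" where
  "least_singular_value V = Inf {norm (V *v x) | x. norm x = 1}"

definition mvn_density :: "real^'d^'d \<Rightarrow> real^'d \<Rightarrow> real" where
  "mvn_density V x =
     exp (- (x \<bullet> (matrix_inv V *v x)) / 2) /
     sqrt ((2 * pi) ^ CARD('d) * det V)"

definition mvn :: "real^'d^'d \<Rightarrow> (real^'d) measure" where
  "mvn V = density lborel (\<lambda>x. ennreal (mvn_density V x))"

definition outer :: "real^'d \<Rightarrow> real^'d^'d" where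
  "outer g = (\<chi> i j. g $ i * g $ j)"

definition wishart :: "real^'d^'d \<Rightarrow> nat \<Rightarrow> (real^'d^'d) measure" where
  "wishart V m = distr (PiM {..<m} (\<lambda>_. mvn V)) borel (\<lambda>g. \<Sum>i<m. outer (g i))"

definition neighbors :: "real^'d^'n \<Rightarrow> real^'d^'n \<Rightarrow> bool" where
  "neighbors A A' \<longleftrightarrow> card {i. A $ i \<noteq> A' $ i} = 1"

definition diff_private ::
  "real \<Rightarrow> real \<Rightarrow> real \<Rightarrow> (real^'d^'n \<Rightarrow> 'b measure) \<Rightarrow> 'b measure \<Rightarrow> bool" where
  "diff_private B \<epsilon> \<delta> ALG M \<longleftrightarrow>
     (\<forall>A A'. (\<forall>i. norm (A $ i) \<le> B) \<longrightarrow> (\<forall>i. norm (A' $ i) \<le> B) \<longrightarrow> neighbors A A' \<longrightarrow>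
       (\<forall>S \<in> sets M. measure (ALG A) S \<le> exp \<epsilon> * measure (ALG A') S + \<delta>))"

definition wishart_mech :: "real^'d^'d \<Rightarrow> nat \<Rightarrow> real^'d^'n \<Rightarrow> (real^'d^'d) measure" where
  "wishart_mech V \<nu> A = distr (wishart V \<nu>) borel (\<lambda>N. transpose A ** A + N)"

end

theory Submission
  imports Defs
begin

text \<open>No Wishart density on symmetric matrices is needed. If \<open>\<nu> = d + j\<close>, the Wishart law is, up to
  a constant, the image under \<open>G \<mapsto> G\<^sup>T G\<close> of the measure \<open>\<bar>det G\<bar>\<^sup>j exp (- tr (V\<^sup>-\<^sup>1 G\<^sup>T G) / 2) dG\<close> on
  square matrices: passing from \<open>j\<close> to \<open>j + 1\<close> adds a Gaussian row \<open>x = G\<^sup>T y\<close>, and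
  \<open>G\<^sup>T (I + y y\<^sup>T) G\<close> is the Gram matrix of \<open>(I + y y\<^sup>T)\<^bsup>1/2\<^esup> G\<close>, so only linear changes of variables occur.

  For a fixed vector \<open>a\<close>, the space of square matrices is foliated by lines on which \<open>G\<^sup>T G\<close> runs through
  \<open>M + z\<^sup>2 a a\<^sup>T\<close> with \<open>M\<close> singular. There the weight is that of a chi-square variable \<open>p z\<^sup>2\<close> with
  \<open>j + 1\<close> degrees of freedom, where \<open>p = a\<^sup>T V\<^sup>-\<^sup>1 a \<le> B\<^sup>2 / C1\<close>. Hence comparing the laws of \<open>N\<close> and
  \<open>N + a a\<^sup>T\<close> amounts to comparing a chi-square variable with its shift by \<open>p\<close>, which is done by bounding the
  likelihood ratio outside Chernoff tails of mass \<open>\<delta> / 4\<close>. Replacing a row \<open>a\<close> by \<open>a'\<close> is a removal of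
  \<open>a a\<^sup>T\<close> followed by an addition of \<open>a' a'\<^sup>T\<close>; the two steps cost \<open>11/20\<close> and \<open>9/20\<close> of \<open>\<epsilon>\<close>.\<close>

section \<open>Integration along fibres and linear changes of variables\<close>

lemma nn_integral_lborel_shift:
  fixes h :: "'a::euclidean_space \<Rightarrow> ennreal"
  assumes [measurable]: "h \<in> borel_measurable borel"
  shows "(\<integral>\<^sup>+x. h (x + t) \<partial>lborel) = (\<integral>\<^sup>+x. h x \<partial>lborel)"
proof -
  have "(\<integral>\<^sup>+x. h x \<partial>lborel) = (\<integral>\<^sup>+x. h x \<partial>density (distr lborel borel (\<lambda>x. t + 1 *\<^sub>R x)) (\<lambda>_. 1))"
    using lborel_affine[of 1 t] by simp
  also have "\<dots> = (\<integral>\<^sup>+x. h (x + t) \<partial>lborel)"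
    by (simp add: nn_integral_density nn_integral_distr add.commute)
  finally show ?thesis by simp
qed

lemma nn_integral_lborel_reflect:
  fixes h :: "'a::euclidean_space \<Rightarrow> ennreal"
  assumes [measurable]: "h \<in> borel_measurable borel"
  shows "(\<integral>\<^sup>+x. h (t - x) \<partial>lborel) = (\<integral>\<^sup>+x. h x \<partial>lborel)"
proof -
  have "(\<integral>\<^sup>+x. h x \<partial>lborel) = (\<integral>\<^sup>+x. h x \<partial>density (distr lborel borel (\<lambda>x. t + (-1) *\<^sub>R x)) (\<lambda>_. 1))"
    using lborel_affine[of "-1" t] by simp
  also have "\<dots> = (\<integral>\<^sup>+x. h (t - x) \<partial>lborel)"
    by (simp add: nn_integral_density nn_integral_distr)
  finally show ?thesis by simp
qed

text \<open>Averaging over translates: insert the integral \<open>1\<close> of the unit-cube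
  indicator, swap the integrals and translate by \<open>L v\<close>. The map \<open>\<pi>\<close>
  serves as a coordinate along the fibres, so the space never has to be split into a
  product.\<close>

lemma nn_integral_lborel_fibre:
  fixes H :: "'a::euclidean_space \<Rightarrow> ennreal" and L :: "'b::euclidean_space \<Rightarrow> 'a"
  assumes [measurable]: "H \<in> borel_measurable borel" "L \<in> borel_measurable borel" "\<pi> \<in> borel_measurable borel"
    and \<pi>: "\<And>x v. \<pi> (x - L v) = \<pi> x - v"
  shows "(\<integral>\<^sup>+x. H x \<partial>lborel) =
    (\<integral>\<^sup>+x. indicator (cbox 0 One) (\<pi> x) * (\<integral>\<^sup>+v. H (x + L v) \<partial>lborel) \<partial>lborel)"
proof -
  let ?\<phi> = "indicator (cbox 0 One) :: 'b \<Rightarrow> ennreal"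
  have \<phi>: "(\<integral>\<^sup>+v. ?\<phi> v \<partial>lborel) = 1"
    by (simp add: emeasure_lborel_cbox_eq)
  have "(\<integral>\<^sup>+x. ?\<phi> (\<pi> x) * (\<integral>\<^sup>+v. H (x + L v) \<partial>lborel) \<partial>lborel)
      = (\<integral>\<^sup>+x. (\<integral>\<^sup>+v. ?\<phi> (\<pi> x) * H (x + L v) \<partial>lborel) \<partial>lborel)"
    by (simp add: nn_integral_cmult)
  also have "\<dots> = (\<integral>\<^sup>+v. (\<integral>\<^sup>+x. ?\<phi> (\<pi> x) * H (x + L v) \<partial>lborel) \<partial>lborel)"
    by (rule lborel_pair.Fubini') measurable
  also have "\<dots> = (\<integral>\<^sup>+v. (\<integral>\<^sup>+x. ?\<phi> (\<pi> x - v) * H x \<partial>lborel) \<partial>lborel)"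
  proof (rule nn_integral_cong)
    fix v
    show "(\<integral>\<^sup>+x. ?\<phi> (\<pi> x) * H (x + L v) \<partial>lborel) = (\<integral>\<^sup>+x. ?\<phi> (\<pi> x - v) * H x \<partial>lborel)"
      using nn_integral_lborel_shift[of "\<lambda>x. ?\<phi> (\<pi> x - v) * H x" "L v"]
      by (simp flip: \<pi>)
  qed
  also have "\<dots> = (\<integral>\<^sup>+x. (\<integral>\<^sup>+v. ?\<phi> (\<pi> x - v) * H x \<partial>lborel) \<partial>lborel)"
    by (rule lborel_pair.Fubini') measurable
  also have "\<dots> = (\<integral>\<^sup>+x. H x \<partial>lborel)"
    by (simp add: nn_integral_multc nn_integral_lborel_reflect \<phi>)
  finally show ?thesis by simp
qed

text \<open>The fibre representation carries a nonnegative weight that is the same for both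
  integrands, so an inequality on every fibre integrates to one on the whole space.\<close>

lemma nn_integral_lborel_fibre_mono:
  fixes H1 H2 :: "'a::euclidean_space \<Rightarrow> ennreal" and L :: "'b::euclidean_space \<Rightarrow> 'a"
  assumes "H1 \<in> borel_measurable borel" "H2 \<in> borel_measurable borel"
    and L: "L \<in> borel_measurable borel" "\<pi> \<in> borel_measurable borel"
    and \<pi>: "\<And>x v. \<pi> (x - L v) = \<pi> x - v"
    and le: "\<And>x. (\<integral>\<^sup>+v. H1 (x + L v) \<partial>lborel) \<le> (\<integral>\<^sup>+v. H2 (x + L v) \<partial>lborel)"
  shows "(\<integral>\<^sup>+x. H1 x \<partial>lborel) \<le> (\<integral>\<^sup>+x. H2 x \<partial>lborel)"
  unfolding nn_integral_lborel_fibre[OF assms(1) L \<pi>] nn_integral_lborel_fibre[OF assms(2) L \<pi>]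
  by (intro nn_integral_mono mult_left_mono le) simp

text \<open>Uniqueness of translation-invariant measure, with an explicit constant: its measurability in
  parameters of the linear map is then evident, and its value is not needed.\<close>

lemma nn_integral_lborel_linear:
  fixes h :: "'a::euclidean_space \<Rightarrow> ennreal" and L :: "'a \<Rightarrow> 'a"
  assumes [measurable]: "h \<in> borel_measurable borel" and L: "linear L" "surj L"
  shows "(\<integral>\<^sup>+x. h (L x) \<partial>lborel) =
    (\<integral>\<^sup>+x. indicator (cbox 0 One) (- L x) \<partial>lborel) * (\<integral>\<^sup>+x. h x \<partial>lborel)"
proof -
  let ?\<phi> = "indicator (cbox 0 One) :: 'a \<Rightarrow> ennreal"
  have [measurable]: "L \<in> borel_measurable borel"
    using L(1) by (simp add: borel_measurable_continuous_onI linear_continuous_on linear_linear)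
  \<comment> \<open>Surjectivity enters here: translating the value by \<open>y = L z\<close> is
    translating the argument by \<open>z\<close>, so the left-hand side is a translation-invariant
    functional of \<open>k\<close>.\<close>
  have inv: "(\<integral>\<^sup>+x. k (L x + y) \<partial>lborel) = (\<integral>\<^sup>+x. k (L x) \<partial>lborel)"
    if [measurable]: "k \<in> borel_measurable borel" for k :: "'a \<Rightarrow> ennreal" and y
  proof -
    obtain z where "y = L z" using L(2) by blast
    then show ?thesis
      using nn_integral_lborel_shift[of "\<lambda>x. k (L x)" z] by (simp add: linear_add[OF L(1)])
  qed
  have \<phi>: "(\<integral>\<^sup>+v. ?\<phi> v \<partial>lborel) = 1"
    by (simp add: emeasure_lborel_cbox_eq)
  have "(\<integral>\<^sup>+x. h (L x) \<partial>lborel) = (\<integral>\<^sup>+y. ?\<phi> y * (\<integral>\<^sup>+x. h (L x + y) \<partial>lborel) \<partial>lborel)"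
    by (simp add: inv nn_integral_multc \<phi>)
  also have "\<dots> = (\<integral>\<^sup>+y. (\<integral>\<^sup>+x. ?\<phi> y * h (L x + y) \<partial>lborel) \<partial>lborel)"
    by (simp add: nn_integral_cmult)
  also have "\<dots> = (\<integral>\<^sup>+x. (\<integral>\<^sup>+y. ?\<phi> y * h (L x + y) \<partial>lborel) \<partial>lborel)"
    by (rule lborel_pair.Fubini') measurable
  also have "\<dots> = (\<integral>\<^sup>+x. (\<integral>\<^sup>+y. ?\<phi> (y - L x) * h y \<partial>lborel) \<partial>lborel)"
  proof (rule nn_integral_cong)
    fix x
    show "(\<integral>\<^sup>+y. ?\<phi> y * h (L x + y) \<partial>lborel) = (\<integral>\<^sup>+y. ?\<phi> (y - L x) * h y \<partial>lborel)"
      using nn_integral_lborel_shift[of "\<lambda>y. ?\<phi> (y - L x) * h y" "L x"] by (simp add: add.commute)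
  qed
  also have "\<dots> = (\<integral>\<^sup>+y. (\<integral>\<^sup>+x. ?\<phi> (y - L x) * h y \<partial>lborel) \<partial>lborel)"
    by (rule lborel_pair.Fubini') measurable
  also have "\<dots> = (\<integral>\<^sup>+y. (\<integral>\<^sup>+x. ?\<phi> (- L x) \<partial>lborel) * h y \<partial>lborel)"
  proof (rule nn_integral_cong)
    fix y
    show "(\<integral>\<^sup>+x. ?\<phi> (y - L x) * h y \<partial>lborel) = (\<integral>\<^sup>+x. ?\<phi> (- L x) \<partial>lborel) * h y"
      using inv[of "\<lambda>z. ?\<phi> (- z)" "- y"] by (simp add: nn_integral_multc)
  qed
  also have "\<dots> = (\<integral>\<^sup>+x. ?\<phi> (- L x) \<partial>lborel) * (\<integral>\<^sup>+y. h y \<partial>lborel)"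
    by (simp add: nn_integral_cmult)
  finally show ?thesis .
qed

lemma borel_measurable_matrix_vector_mult [measurable]:
  "(\<lambda>x. (A::real^'n^'m) *v x) \<in> borel_measurable borel"
  by (intro borel_measurable_continuous_onI continuous_intros)

lemma surj_matrix_vector_mult:
  fixes A :: "real^'n^'n"
  assumes "det A \<noteq> 0"
  shows "surj ((*v) A)"
  using assms by (metis invertible_det_nz invertible_eq_bij bij_is_surj)

text \<open>The library's linear change of variables is restricted to well-ordered index types.\<close>

lemma nn_integral_lborel_matrix:
  fixes h :: "real^'n \<Rightarrow> ennreal" and A :: "real^'n^'n"
  assumes h: "h \<in> borel_measurable borel" and A: "det A \<noteq> 0"
  shows "ennreal \<bar>det A\<bar> * (\<integral>\<^sup>+x. h (A *v x) \<partial>lborel) = (\<integral>\<^sup>+x. h x \<partial>lborel)"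
proof -
  define C :: "real^'n^'n \<Rightarrow> ennreal"
    where "C A = (\<integral>\<^sup>+x. indicator (cbox 0 One) (- (A *v x)) \<partial>lborel)" for A
  have lin: "(\<integral>\<^sup>+x. h (A *v x) \<partial>lborel) = C A * (\<integral>\<^sup>+x. h x \<partial>lborel)"
    if "h \<in> borel_measurable borel" "det A \<noteq> 0" for A and h :: "real^'n \<Rightarrow> ennreal"
    unfolding C_def by (rule nn_integral_lborel_linear) (use that surj_matrix_vector_mult in auto)
  \<comment> \<open>The claim amounts to \<open>ratio A = 1\<close>. Since \<open>ratio\<close> is
    multiplicative, it is enough to check the elementary matrices that generate the invertible
    ones.\<close>
  define ratio where "ratio A = C A * ennreal \<bar>det A\<bar>" for A
  have ratio_mult: "ratio (A ** B) = ratio A * ratio B" if "det A \<noteq> 0" "det B \<noteq> 0" for A B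
  proof -
    have "C (A ** B) = C A * C B"
      using lin[of "\<lambda>x. indicator (cbox 0 One) (- (A *v x))" B] that
      by (simp add: C_def matrix_vector_mul_assoc[symmetric] mult.commute)
    then show ?thesis
      by (simp add: ratio_def det_mul abs_mult ennreal_mult mult_ac)
  qed
  have sq: "x = 1" if "x * x = 1" for x :: ennreal
    using that
  proof (cases x)
    case (real r)
    with that have "r * r = 1" "0 \<le> r"
      by (auto simp flip: ennreal_mult ennreal_1)
    then show ?thesis using real
      by (metis abs_of_nonneg ennreal_1 power2_eq_1_iff power2_eq_square square_eq_1_iff abs_minus abs_one)
  qed auto
  have diag: "ratio A = 1" if A: "\<And>i j. i \<noteq> j \<Longrightarrow> A $ i $ j = 0" and "det A \<noteq> 0" for A
  proof -
    have nz: "A $ i $ i \<noteq> 0" for i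
      using \<open>det A \<noteq> 0\<close> det_diagonal[of A, OF A] by simp
    have Ax: "(A *v x) $ i = A $ i $ i * x $ i" for x i
    proof -
      have "(\<Sum>j\<in>UNIV. A $ i $ j * x $ j) = (\<Sum>j\<in>UNIV. if j = i then A $ i $ i * x $ i else 0)"
        by (rule sum.cong) (auto simp: A)
      then show ?thesis by (simp add: matrix_vector_mult_def)
    qed
    \<comment> \<open>The affine rule for Lebesgue measure takes one scaling factor per basis
      vector; \<open>c\<close> reads the diagonal entry off \<open>axis i 1\<close>.\<close>
    define c where "c b = (\<Sum>i\<in>UNIV. b $ i * A $ i $ i)" for b :: "real^'n"
    have c: "c (axis i 1) = A $ i $ i" for i
      by (simp add: c_def axis_def if_distrib if_distribR cong: if_cong)
    have Basis: "(Basis :: (real^'n) set) = (\<lambda>i. axis i 1) ` UNIV"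
      by (auto simp: Basis_vec_def)
    have inj: "inj (\<lambda>i::'n. axis i (1::real))"
      by (auto simp: inj_def axis_eq_axis)
    have T: "0 + (\<Sum>j\<in>Basis. (c j * (x \<bullet> j)) *\<^sub>R j) = A *v x" for x
      unfolding Basis sum.reindex[OF inj] comp_def c inner_axis
      by (simp add: vec_eq_iff Ax) (simp add: axis_def if_distrib if_distribR cong: if_cong)
    have P: "(\<Prod>j\<in>Basis. \<bar>c j\<bar>) = \<bar>det A\<bar>"
      unfolding Basis prod.reindex[OF inj] comp_def c by (simp add: det_diagonal[of A, OF A] abs_prod)
    have lb: "lborel = density (distr lborel borel ((*v) A)) (\<lambda>_. ennreal \<bar>det A\<bar>)"
      by (rule lborel_affine_euclidean[of c 0, unfolded T P]) (auto simp: Basis c nz)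
    have "(1::ennreal) = (\<integral>\<^sup>+x. indicator (cbox 0 One) (- x :: real^'n) \<partial>lborel)"
      using nn_integral_lborel_reflect[of "indicator (cbox 0 One) :: real^'n \<Rightarrow> _" 0]
      by (simp add: emeasure_lborel_cbox_eq)
    also have "\<dots> = (\<integral>\<^sup>+x. indicator (cbox 0 One) (- x :: real^'n)
        \<partial>density (distr lborel borel ((*v) A)) (\<lambda>_. ennreal \<bar>det A\<bar>))"
      using lb by simp
    also have "\<dots> = ennreal \<bar>det A\<bar> * C A"
      by (simp add: nn_integral_density nn_integral_distr nn_integral_cmult C_def)
    finally show ?thesis by (simp add: ratio_def mult.commute)
  qed
  \<comment> \<open>For an involution, \<open>ratio S * ratio S\<close> is the ratio of the
    identity, hence \<open>1\<close>, and \<open>1\<close> has only one square root among the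
    nonnegative extended reals.\<close>
  have invol: "ratio S = 1" if "S ** S = mat 1" for S
  proof -
    have "det S * det S = 1" using that by (metis det_I det_mul)
    then have "det S \<noteq> 0" by auto
    moreover have "ratio (mat 1) = 1" by (rule diag) (simp_all add: mat_def det_I[unfolded mat_def])
    ultimately have "ratio S * ratio S = 1" using ratio_mult[of S S] that by simp
    then show ?thesis by (rule sq)
  qed
  have "det A \<noteq> 0 \<longrightarrow> ratio A = 1"
  proof (rule induct_matrix_elementary_alt)
    fix A B :: "real^'n^'n"
    assume "det A \<noteq> 0 \<longrightarrow> ratio A = 1" "det B \<noteq> 0 \<longrightarrow> ratio B = 1"
    then show "det (A ** B) \<noteq> 0 \<longrightarrow> ratio (A ** B) = 1"
      by (auto simp: det_mul ratio_mult)
  next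
    fix A :: "real^'n^'n" and i
    assume "row i A = 0"
    then show "det A \<noteq> 0 \<longrightarrow> ratio A = 1"
      by (simp add: det_zero_row(2))
  next
    fix A :: "real^'n^'n"
    assume "\<And>i j. i \<noteq> j \<Longrightarrow> A$i$j = 0"
    then show "det A \<noteq> 0 \<longrightarrow> ratio A = 1"
      using diag by blast
  next
    fix m n :: 'n
    let ?S = "(\<chi> i j. mat 1 $ i $ Transposition.transpose m n j) :: real^'n^'n"
    have "(?S ** ?S) $ i $ j = mat 1 $ i $ j" for i j
    proof -
      let ?t = "Transposition.transpose m n"
      have "(?S ** ?S) $ i $ j = (\<Sum>k\<in>UNIV. if k = ?t j then mat 1 $ i $ ?t k else 0)"
        unfolding matrix_matrix_mult_def vec_lambda_beta by (rule sum.cong) (auto simp: mat_def)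
      then show ?thesis by simp
    qed
    then have S: "?S ** ?S = mat 1"
      by (simp add: vec_eq_iff)
    show "det ?S \<noteq> 0 \<longrightarrow> ratio ?S = 1"
      using invol[OF S] by simp
  next
    fix m n :: 'n
    assume mn: "m \<noteq> n"
    let ?S = "(\<chi> i j. of_bool (i = m \<and> j = n \<or> i = j)) :: real^'n^'n"
    \<comment> \<open>A shear is not an involution, but it becomes one after flipping the sign of
      its row \<open>m\<close>, and that sign flip is a diagonal matrix.\<close>
    let ?D = "(\<chi> i j. if i = j then (if i = m then -1 else 1) else 0) :: real^'n^'n"
    have "(?D ** ?S) $ i $ j = (if i = m then - of_bool (j = n \<or> j = m) else of_bool (i = j))" for i j
    proof -
      have "(?D ** ?S) $ i $ j = (\<Sum>k\<in>UNIV. if k = i then (if i = m then -1 else 1) * ?S $ i $ j else 0)"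
        unfolding matrix_matrix_mult_def vec_lambda_beta by (rule sum.cong) auto
      then show ?thesis by (cases "i = m") auto
    qed
    then have DS: "?D ** ?S = (\<chi> i j. if i = m then - of_bool (j = n \<or> j = m) else of_bool (i = j))"
      by (simp add: vec_eq_iff)
    let ?E = "(\<chi> i j. if i = m then - of_bool (j = n \<or> j = m) else of_bool (i = j)) :: real^'n^'n"
    have "(?E ** ?E) $ i $ j = mat 1 $ i $ j" for i j
    proof (cases "i = m")
      case True
      have "(?E ** ?E) $ i $ j = (\<Sum>k\<in>{m,n}. - ?E $ k $ j)"
        unfolding matrix_matrix_mult_def vec_lambda_beta using True mn
        by (intro sum.mono_neutral_cong_right) auto
      then show ?thesis using True mn by (auto simp: mat_def)
    next
      case False
      have "(?E ** ?E) $ i $ j = (\<Sum>k\<in>{i}. ?E $ k $ j)"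
        unfolding matrix_matrix_mult_def vec_lambda_beta using False
        by (intro sum.mono_neutral_cong_right) auto
      then show ?thesis using False by (auto simp: mat_def)
    qed
    then have "?E ** ?E = mat 1"
      by (simp add: vec_eq_iff)
    then have I: "(?D ** ?S) ** (?D ** ?S) = mat 1"
      by (simp only: DS)
    have D: "det ?D \<noteq> 0"
      by (subst det_diagonal) auto
    have "ratio ?D = 1"
      by (rule diag) (use D in auto)
    then show "det ?S \<noteq> 0 \<longrightarrow> ratio ?S = 1"
      using ratio_mult[OF D, of ?S] invol[OF I] by simp
  qed
  with A have "ratio A = 1" by blast
  then show ?thesis
    using lin[OF h A] by (simp add: ratio_def mult.assoc[symmetric] mult.commute)
qed

section \<open>Gram matrices\<close>

definition gram :: "real^'d^'n \<Rightarrow> real^'d^'d" where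
  "gram G = transpose G ** G"

definition outer_prod :: "real^'n \<Rightarrow> real^'d \<Rightarrow> real^'d^'n" where
  "outer_prod g a = (\<chi> i j. g $ i * a $ j)"

lemma gram_nth: "gram G $ i $ j = (\<Sum>k\<in>UNIV. G $ k $ i * G $ k $ j)"
  by (simp add: gram_def matrix_matrix_mult_def transpose_def)

lemma det_gram: "det (gram (G::real^'d^'d)) = (det G)\<^sup>2"
  by (simp add: gram_def det_mul det_transpose power2_eq_square)

lemma continuous_on_det: "continuous_on S (\<lambda>A::real^'d^'d. det A)"
  unfolding det_def by (intro continuous_intros)

lemma borel_measurable_det [measurable]: "(\<lambda>A::real^'d^'d. det A) \<in> borel_measurable borel"
  by (intro borel_measurable_continuous_onI continuous_on_det)

lemma borel_measurable_gram [measurable]: "gram \<in> borel_measurable borel"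
proof (rule borel_measurable_continuous_onI)
  have "continuous_on UNIV (\<lambda>G::real^'a^'b. \<chi> i j. \<Sum>k\<in>UNIV. G $ k $ i * G $ k $ j)"
    by (intro continuous_intros)
  also have "(\<lambda>G::real^'a^'b. \<chi> i j. \<Sum>k\<in>UNIV. G $ k $ i * G $ k $ j) = gram"
    by (simp add: fun_eq_iff vec_eq_iff gram_nth)
  finally show "continuous_on UNIV (gram :: real^'a^'b \<Rightarrow> _)" .
qed

lemma borel_measurable_outer_prod [measurable]: "(\<lambda>g. outer_prod g a) \<in> borel_measurable borel"
  unfolding outer_prod_def by (intro borel_measurable_continuous_onI continuous_intros)

lemma borel_measurable_outer [measurable]: "outer \<in> borel_measurable borel"
  unfolding outer_def[abs_def] by (intro borel_measurable_continuous_onI continuous_intros)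

section \<open>Singular square matrices form a null set\<close>

text \<open>The determinant is a polynomial in \<open>t\<close>. It is not the zero polynomial,
  because for \<open>t\<close> above a bound on the operator norm of \<open>A\<close> no nonzero
  \<open>x\<close> satisfies \<open>A x = - t x\<close>.\<close>

lemma finite_det_add_scaleR_mat_eq_0:
  fixes A :: "real^'d^'d"
  shows "finite {t. det (A + t *\<^sub>R mat 1) = 0}"
proof -
  define P :: "real poly" where "P = (\<Sum>p | p permutes (UNIV::'d set).
     [:of_int (sign p):] * (\<Prod>i\<in>UNIV. [:A $ i $ p i, mat 1 $ i $ p i:]))"
  have P: "poly P t = det (A + t *\<^sub>R mat 1)" for t
    by (simp add: P_def det_def poly_sum poly_prod algebra_simps)
  obtain K where K: "\<And>x. norm (A *v x) \<le> norm x * K"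
    using bounded_linear.bounded[OF matrix_vector_mul_bounded_linear[of A]] by blast
  have "det (A + (\<bar>K\<bar> + 1) *\<^sub>R mat 1) \<noteq> 0"
  proof
    assume "det (A + (\<bar>K\<bar> + 1) *\<^sub>R mat 1) = 0"
    then obtain x where x: "x \<noteq> 0" "(A + (\<bar>K\<bar> + 1) *\<^sub>R mat 1) *v x = 0"
      by (metis invertible_det_nz invertible_left_inverse matrix_left_invertible_ker)
    then have "A *v x = - ((\<bar>K\<bar> + 1) *\<^sub>R x)"
      by (simp add: matrix_vector_mult_add_rdistrib scaleR_matrix_vector_assoc[symmetric] eq_neg_iff_add_eq_0)
    then have "(\<bar>K\<bar> + 1) * norm x = norm (A *v x)" by simp
    also have "\<dots> \<le> norm x * K" by (rule K)
    also have "\<dots> \<le> \<bar>K\<bar> * norm x" by (simp add: mult.commute mult_right_mono)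
    finally show False using x by (simp add: distrib_right)
  qed
  then have "P \<noteq> 0" using P by fastforce
  then show ?thesis using poly_roots_finite[of P] by (simp add: P)
qed

text \<open>The lines \<open>G + t I\<close> fill the space of matrices, and each of them meets the
  singular matrices in a finite set only.\<close>

lemma AE_det_nonzero: "AE G in lborel. det (G::real^'d^'d) \<noteq> 0"
proof -
  \<comment> \<open>The index is arbitrary: every diagonal entry is a coordinate along the direction
    \<open>mat 1\<close>.\<close>
  let ?i = "undefined :: 'd"
  have "(\<integral>\<^sup>+G. indicator {G::real^'d^'d. det G = 0} G \<partial>lborel) =
     (\<integral>\<^sup>+G. indicator (cbox 0 One) (G $ ?i $ ?i) *
        (\<integral>\<^sup>+t. indicator {G. det G = 0} (G + t *\<^sub>R (mat 1 :: real^'d^'d)) \<partial>lborel) \<partial>lborel)"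
    by (rule nn_integral_lborel_fibre[where \<pi> = "\<lambda>G. G $ ?i $ ?i" and L = "\<lambda>t. t *\<^sub>R mat 1"])
      (auto simp: mat_def intro!: borel_measurable_continuous_onI continuous_intros)
  moreover have "(\<integral>\<^sup>+t. indicator {G. det G = 0} (G + t *\<^sub>R mat 1) \<partial>lborel) = (0::ennreal)" for G :: "real^'d^'d"
  proof -
    have [measurable]: "{t. det (G + t *\<^sub>R mat 1) = 0} \<in> sets lborel"
      by (intro finite_imp_null_set_lborel[THEN null_setsD2] finite_det_add_scaleR_mat_eq_0)
    have "(\<integral>\<^sup>+t. indicator {G. det G = 0} (G + t *\<^sub>R mat 1) \<partial>lborel)
        = emeasure lborel {t. det (G + t *\<^sub>R mat 1) = 0}"
      by (subst nn_integral_indicator[symmetric], measurable) (intro nn_integral_cong, simp add: indicator_def)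
    then show ?thesis
      by (simp add: finite_imp_null_set_lborel finite_det_add_scaleR_mat_eq_0 null_setsD1)
  qed
  ultimately have "emeasure lborel {G::real^'d^'d. det G = 0} = 0" by simp
  then show ?thesis by (subst AE_iff_measurable[OF _ refl]) auto
qed

section \<open>Rank-one perturbations of square matrices\<close>

lemma matrix_add_rdistrib: "((A::real^'n^'m) + B) ** C = A ** C + B ** C"
  by (vector matrix_matrix_mult_def sum.distrib[symmetric] field_simps)

lemma matrix_mult_outer: "A ** outer x ** transpose A = outer (A *v x)"
proof -
  have "(\<Sum>l\<in>UNIV. (\<Sum>k\<in>UNIV. A $ i $ k * (x $ k * x $ l)) * A $ j $ l) =
      (\<Sum>k\<in>UNIV. A $ i $ k * x $ k) * (\<Sum>l\<in>UNIV. A $ j $ l * x $ l)" for i j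
  proof -
    have "(\<Sum>l\<in>UNIV. (\<Sum>k\<in>UNIV. A $ i $ k * (x $ k * x $ l)) * A $ j $ l) =
        (\<Sum>l\<in>UNIV. \<Sum>k\<in>UNIV. A $ i $ k * x $ k * (A $ j $ l * x $ l))"
      by (intro sum.cong refl) (simp add: sum_distrib_left mult_ac)
    also have "\<dots> = (\<Sum>k\<in>UNIV. \<Sum>l\<in>UNIV. A $ i $ k * x $ k * (A $ j $ l * x $ l))"
      by (rule sum.swap)
    finally show ?thesis by (simp only: sum_product)
  qed
  then show ?thesis
    by (simp add: vec_eq_iff matrix_matrix_mult_def outer_def transpose_def matrix_vector_mult_def)
qed

text \<open>In an orthonormal basis containing \<open>n\<close> the matrix is diagonal, with one
  entry \<open>1 + s\<close> and all others \<open>1\<close>.\<close>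

lemma det_mat_add_outer:
  fixes n :: "real^'d"
  assumes "norm n = 1"
  shows "det (mat 1 + s *\<^sub>R outer n) = 1 + s"
proof -
  obtain k Q where Q: "orthogonal_matrix Q" "Q *v axis k 1 = n"
    using orthogonal_matrix_exists_basis[OF assms] by metis
  let ?D = "mat 1 + s *\<^sub>R outer (axis k 1) :: real^'d^'d"
  have o: "Q ** outer (axis k 1) ** transpose Q = outer n"
    by (simp add: matrix_mult_outer Q(2))
  have "Q ** ?D ** transpose Q = mat 1 + s *\<^sub>R outer n"
    using Q(1) by (simp add: matrix_add_ldistrib matrix_add_rdistrib orthogonal_matrix_def
        matrix_scalar_ac o flip: scalar_matrix_assoc)
  moreover have "det Q * det (transpose Q) = 1"
    using Q(1) by (metis det_I det_mul orthogonal_matrix_def det_transpose mult.commute)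
  moreover have "det ?D = 1 + s"
  proof -
    have "det ?D = (\<Prod>i\<in>UNIV. ?D $ i $ i)"
      by (rule det_diagonal) (auto simp: mat_def outer_def axis_def)
    also have "\<dots> = (\<Prod>i\<in>UNIV. if i = k then 1 + s else 1)"
      by (rule prod.cong) (auto simp: mat_def outer_def axis_def)
    finally show ?thesis by simp
  qed
  ultimately show ?thesis
    by (metis det_mul mult.commute mult.left_commute mult_1)
qed

lemma vector_matrix_mult_nth: "(n v* G) $ j = (\<Sum>k\<in>UNIV. G $ k $ j * n $ k :: real)"
  by (simp add: vector_matrix_mult_def mult.commute)

text \<open>Every column of \<open>G\<close> is orthogonal to \<open>n\<close>, so the cross terms
  vanish and only the square of the perturbation survives.\<close>

lemma gram_add_outer_prod:
  assumes 0: "transpose G *v n = 0" and n: "norm n = 1"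
  shows "gram (G + s *\<^sub>R outer_prod n a) = gram G + s\<^sup>2 *\<^sub>R outer a"
proof -
  have 0: "(\<Sum>k\<in>UNIV. G $ k $ j * n $ k) = 0" for j
    using arg_cong[OF 0, of "\<lambda>x. x $ j"] by (simp add: vector_matrix_mult_nth)
  have n: "(\<Sum>k\<in>UNIV. n $ k * n $ k) = 1"
    using n by (metis inner_vec_def inner_real_def norm_eq_1)
  have "(\<Sum>k\<in>UNIV. (G $ k $ i + s * (n $ k * a $ i)) * (G $ k $ j + s * (n $ k * a $ j)))
      = (\<Sum>k\<in>UNIV. G $ k $ i * G $ k $ j) + (s * a $ j) * (\<Sum>k\<in>UNIV. G $ k $ i * n $ k)
        + (s * a $ i) * (\<Sum>k\<in>UNIV. G $ k $ j * n $ k) + s\<^sup>2 * (a $ i * a $ j) * (\<Sum>k\<in>UNIV. n $ k * n $ k)" for i j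
    by (simp add: sum_distrib_left sum.distrib[symmetric] algebra_simps power2_eq_square)
  then show ?thesis
    by (simp add: vec_eq_iff gram_nth outer_prod_def outer_def 0 n)
qed

text \<open>As \<open>outer n ** G = 0\<close>, stretching by the factor \<open>s\<close> in
  direction \<open>n\<close> turns \<open>G + outer_prod n a\<close> into
  \<open>G + s *\<^sub>R outer_prod n a\<close>, and this stretching has determinant
  \<open>s\<close>.\<close>

lemma det_add_outer_prod:
  fixes G :: "real^'d^'d"
  assumes 0: "transpose G *v n = 0" and n: "norm n = 1"
  shows "det (G + s *\<^sub>R outer_prod n a) = s * det (G + outer_prod n a)"
proof -
  have 0: "(\<Sum>k\<in>UNIV. G $ k $ j * n $ k) = 0" for j
    using arg_cong[OF 0, of "\<lambda>x. x $ j"] by (simp add: vector_matrix_mult_nth)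
  have n1: "(\<Sum>k\<in>UNIV. n $ k * n $ k) = 1"
    using n by (metis inner_vec_def inner_real_def norm_eq_1)
  have "(outer n ** (G + outer_prod n a)) $ i $ j = outer_prod n a $ i $ j" for i j
  proof -
    have "(\<Sum>k\<in>UNIV. n $ i * n $ k * (G $ k $ j + n $ k * a $ j))
        = n $ i * (\<Sum>k\<in>UNIV. G $ k $ j * n $ k) + n $ i * a $ j * (\<Sum>k\<in>UNIV. n $ k * n $ k)"
      by (simp add: sum_distrib_left sum.distrib[symmetric] algebra_simps)
    then show ?thesis
      by (simp add: matrix_matrix_mult_def outer_def outer_prod_def 0 n1)
  qed
  then have o: "outer n ** (G + outer_prod n a) = outer_prod n a"
    by (simp add: vec_eq_iff)
  have "(mat 1 + (s - 1) *\<^sub>R outer n) ** (G + outer_prod n a)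
      = (G + outer_prod n a) + (s - 1) *\<^sub>R (outer n ** (G + outer_prod n a))"
    by (simp add: matrix_add_rdistrib scalar_matrix_assoc)
  also have "\<dots> = G + s *\<^sub>R outer_prod n a"
    unfolding o by (simp add: algebra_simps)
  finally show ?thesis
    using det_mul[of "mat 1 + (s - 1) *\<^sub>R outer n" "G + outer_prod n a"] det_mat_add_outer[OF n, of "s - 1"]
    by simp
qed

section \<open>Lines along which the Gram matrix moves in one direction\<close>

text \<open>A singular transpose has a kernel vector, which gives \<open>\<mu> = 0\<close>;
  otherwise \<open>transpose G *v n = a\<close> can be solved. Normalising \<open>n\<close> only
  rescales \<open>\<mu>\<close>.\<close>

lemma exists_unit_transpose_parallel:
  fixes G :: "real^'d^'d"
  assumes a: "a \<noteq> 0"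
  obtains n \<mu> where "norm n = 1" "transpose G *v n = \<mu> *\<^sub>R a"
proof -
  have "\<exists>n. n \<noteq> 0 \<and> (\<exists>\<mu>. transpose G *v n = \<mu> *\<^sub>R a)"
  proof (cases "det (transpose G) = 0")
    case True
    then obtain n where "n \<noteq> 0" "transpose G *v n = 0"
      by (metis invertible_det_nz invertible_left_inverse matrix_left_invertible_ker)
    then show ?thesis by (metis scaleR_zero_left)
  next
    case False
    obtain n where n: "transpose G *v n = a" using surj_matrix_vector_mult[OF False] by (metis surjD)
    then have "n \<noteq> 0" using a by auto
    then show ?thesis using n by (metis scaleR_one)
  qed
  then obtain n \<mu> where n: "n \<noteq> 0" "transpose G *v n = \<mu> *\<^sub>R a" by blast
  show thesis
  proof
    show "norm (n /\<^sub>R norm n) = 1" using n by simp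
    show "transpose G *v (n /\<^sub>R norm n) = (\<mu> / norm n) *\<^sub>R a"
      using n(2) by (simp add: matrix_vector_mult_scaleR divide_inverse mult.commute)
  qed
qed

text \<open>For fixed \<^term>\<open>G\<close>, the matrices \<^term>\<open>G + outer_prod g a\<close> are foliated by lines in a direction
  \<^term>\<open>outer_prod n a\<close> along which the Gram matrix only moves along \<^term>\<open>outer a\<close>.\<close>

lemma nn_integral_gram_fibre_mono:
  fixes F1 F2 :: "real^'d^'d \<Rightarrow> ennreal"
  assumes [measurable]: "F1 \<in> borel_measurable borel" "F2 \<in> borel_measurable borel"
    and a: "a \<noteq> 0"
    and le: "\<And>M c. 0 \<le> c \<Longrightarrow> (\<And>z. det (M + z\<^sup>2 *\<^sub>R outer a) = c * z\<^sup>2) \<Longrightarrow>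
      (\<integral>\<^sup>+z. F1 (M + z\<^sup>2 *\<^sub>R outer a) \<partial>lborel) \<le> (\<integral>\<^sup>+z. F2 (M + z\<^sup>2 *\<^sub>R outer a) \<partial>lborel)"
  shows "(\<integral>\<^sup>+G. F1 (gram (G::real^'d^'d)) \<partial>lborel) \<le> (\<integral>\<^sup>+G. F2 (gram (G::real^'d^'d)) \<partial>lborel)"
proof (rule nn_integral_lborel_fibre_mono[where L = "\<lambda>g. outer_prod g a" and \<pi> = "\<lambda>G. (1 / (a \<bullet> a)) *\<^sub>R (G *v a)"])
  show "(\<lambda>G::real^'d^'d. (1 / (a \<bullet> a)) *\<^sub>R (G *v a)) \<in> borel_measurable borel"
    unfolding matrix_vector_mult_def by (intro borel_measurable_continuous_onI continuous_intros)
  show "(1 / (a \<bullet> a)) *\<^sub>R ((G - outer_prod g a) *v a) = (1 / (a \<bullet> a)) *\<^sub>R (G *v a) - g" for G :: "real^'d^'d" and g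
  proof -
    have "outer_prod g a *v a = (a \<bullet> a) *\<^sub>R g"
      by (simp add: vec_eq_iff matrix_vector_mult_def outer_prod_def inner_vec_def sum_distrib_left mult_ac)
    then show ?thesis using a by (simp add: matrix_vector_mult_diff_rdistrib scaleR_diff_right)
  qed
  fix G :: "real^'d^'d"
  obtain n \<mu> where n: "norm n = 1" and \<mu>: "transpose G *v n = \<mu> *\<^sub>R a"
    using exists_unit_transpose_parallel[OF a] by metis
  have nn: "(\<Sum>k\<in>UNIV. n $ k * n $ k) = 1"
    using n by (metis inner_vec_def inner_real_def norm_eq_1)
  show "(\<integral>\<^sup>+g. F1 (gram (G + outer_prod g a)) \<partial>lborel) \<le> (\<integral>\<^sup>+g. F2 (gram (G + outer_prod g a)) \<partial>lborel)"
  \<comment> \<open>The direction \<open>n\<close> depends on \<open>G\<close>, hence the two nested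
    fibrations: with \<open>G\<close> fixed, \<open>n\<close> serves for all \<open>x\<close>,
    because adding \<open>outer_prod x a\<close> keeps \<open>transpose G *v n\<close> parallel to
    \<open>a\<close>.\<close>
  proof (rule nn_integral_lborel_fibre_mono[where L = "\<lambda>z. z *\<^sub>R n" and \<pi> = "\<lambda>x. x \<bullet> n"])
    show "(x - z *\<^sub>R n) \<bullet> n = x \<bullet> n - z" for x z
      using n by (simp add: inner_diff_left norm_eq_1)
    fix x
    \<comment> \<open>The point of the line whose transpose annihilates \<open>n\<close>: the matrix
      \<open>G\<close> contributes \<open>\<mu>\<close> times \<open>a\<close> and
      \<open>outer_prod x a\<close> contributes \<open>x \<bullet> n\<close> times \<open>a\<close>;
      both are subtracted.\<close>
    define G1 where "G1 = G + outer_prod x a - (\<mu> + x \<bullet> n) *\<^sub>R outer_prod n a"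
    have "(transpose G1 *v n) $ j = 0" for j
    proof -
      have "(\<Sum>k\<in>UNIV. (G $ k $ j + x $ k * a $ j - (\<mu> + x \<bullet> n) * (n $ k * a $ j)) * n $ k) =
         (\<Sum>k\<in>UNIV. G $ k $ j * n $ k) + a $ j * (\<Sum>k\<in>UNIV. x $ k * n $ k)
         - (\<mu> + x \<bullet> n) * a $ j * (\<Sum>k\<in>UNIV. n $ k * n $ k)"
        by (simp add: sum_distrib_left sum.distrib[symmetric] sum_subtractf[symmetric] algebra_simps)
      also have "\<dots> = 0"
        using arg_cong[OF \<mu>, of "\<lambda>x. x $ j"] by (simp add: vector_matrix_mult_nth nn inner_vec_def algebra_simps)
      finally show ?thesis
        by (simp add: vector_matrix_mult_nth G1_def outer_prod_def)
    qed
    then have G1: "transpose G1 *v n = 0" by (simp add: vec_eq_iff)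
    have line: "gram (G + outer_prod (x + z *\<^sub>R n) a) = gram G1 + (z + (\<mu> + x \<bullet> n))\<^sup>2 *\<^sub>R outer a" for z
    proof -
      have "G + outer_prod (x + z *\<^sub>R n) a = G1 + (z + (\<mu> + x \<bullet> n)) *\<^sub>R outer_prod n a"
        by (simp add: G1_def vec_eq_iff outer_prod_def algebra_simps)
      then show ?thesis using gram_add_outer_prod[OF G1 n] by simp
    qed
    have c: "det (gram G1 + z\<^sup>2 *\<^sub>R outer a) = (det (G1 + outer_prod n a))\<^sup>2 * z\<^sup>2" for z
      unfolding gram_add_outer_prod[OF G1 n, symmetric] det_gram det_add_outer_prod[OF G1 n]
      by (simp add: power_mult_distrib)
    have sh: "(\<integral>\<^sup>+z. F (gram G1 + (z + (\<mu> + x \<bullet> n))\<^sup>2 *\<^sub>R outer a) \<partial>lborel)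
        = (\<integral>\<^sup>+z. F (gram G1 + z\<^sup>2 *\<^sub>R outer a) \<partial>lborel)"
      if [measurable]: "F \<in> borel_measurable borel" for F :: "real^'d^'d \<Rightarrow> ennreal"
      by (rule nn_integral_lborel_shift[where h = "\<lambda>z. F (gram G1 + z\<^sup>2 *\<^sub>R outer a)"]) measurable
    show "(\<integral>\<^sup>+z. F1 (gram (G + outer_prod (x + z *\<^sub>R n) a)) \<partial>lborel)
       \<le> (\<integral>\<^sup>+z. F2 (gram (G + outer_prod (x + z *\<^sub>R n) a)) \<partial>lborel)"
      unfolding line sh[OF assms(1)] sh[OF assms(2)] by (rule le[OF _ c]) simp
  qed measurable
qed measurable

section \<open>The substitution of a square\<close>

text \<open>With \<open>y = z^2\<close>, each half-line contributes the Jacobian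
  \<open>1 / (2 sqrt y)\<close>, and the two half-lines cancel the \<open>2\<close>.\<close>

lemma nn_integral_power2:
  fixes K :: "real \<Rightarrow> ennreal"
  assumes [measurable]: "K \<in> borel_measurable borel"
  shows "(\<integral>\<^sup>+z. K (z\<^sup>2) \<partial>lborel) = (\<integral>\<^sup>+y. K y * ennreal (if 0 < y then y powr (- 1 / 2) else 0) \<partial>lborel)"
proof -
  let ?w = "\<lambda>y. ennreal (if 0 < y then y powr (- 1 / 2) else 0)"
  have half: "(\<integral>\<^sup>+y. K y * ?w y * indicator {0..} y \<partial>lborel) = (\<integral>\<^sup>+z. 2 * K (z\<^sup>2) * indicator {0<..} z \<partial>lborel)"
  proof -
    \<comment> \<open>Substitution takes place on compact intervals, which then exhaust the
      half-line by monotone convergence. The \<open>+ 1\<close> keeps the interval nondegenerate for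
      \<open>n = 0\<close>.\<close>
    have 1: "(\<integral>\<^sup>+y. K y * ?w y * indicator {0..(real n + 1)\<^sup>2} y \<partial>lborel)
        = (\<integral>\<^sup>+z. 2 * K (z\<^sup>2) * indicator {0<..real n + 1} z \<partial>lborel)" for n
    proof -
      have "(\<integral>\<^sup>+y. K y * ?w y * indicator {0\<^sup>2..(real n + 1)\<^sup>2} y \<partial>lborel)
        = (\<integral>\<^sup>+z. K (z\<^sup>2) * ?w (z\<^sup>2) * ennreal (2 * z) * indicator {0..real n + 1} z \<partial>lborel)"
        by (rule nn_integral_substitution_aux[where g = "\<lambda>z. z\<^sup>2"])
          (auto intro!: derivative_eq_intros continuous_intros)
      also have "\<dots> = (\<integral>\<^sup>+z. 2 * K (z\<^sup>2) * indicator {0<..real n + 1} z \<partial>lborel)"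
      proof (rule nn_integral_cong)
        fix z :: real
        show "K (z\<^sup>2) * ?w (z\<^sup>2) * ennreal (2 * z) * indicator {0..real n + 1} z
          = 2 * K (z\<^sup>2) * indicator {0<..real n + 1} z"
        proof (cases "0 < z")
          case True
          have "(z\<^sup>2) powr (- 1 / 2) = 1 / z"
            using True by (simp add: powr_minus_divide powr_half_sqrt)
          then have "?w (z\<^sup>2) * ennreal (2 * z) = 2"
            using True by (simp add: ennreal_mult[symmetric])
          then have "K (z\<^sup>2) * ?w (z\<^sup>2) * ennreal (2 * z) = 2 * K (z\<^sup>2)"
            by (metis mult.assoc mult.commute)
          then show ?thesis
            unfolding indicator_def using True by simp
        qed (auto simp: indicator_def)
      qed
      finally show ?thesis by simp
    qed
    have UN: "(\<integral>\<^sup>+x. f x * indicator (\<Union>n. A n) x \<partial>lborel) = (SUP n. \<integral>\<^sup>+x. f x * indicator (A n) x \<partial>lborel)"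
      if [measurable]: "f \<in> borel_measurable borel" "\<And>n. A n \<in> sets borel" and "incseq A"
      for f :: "real \<Rightarrow> ennreal" and A :: "nat \<Rightarrow> real set"
      using SUP_emeasure_incseq[of A "density lborel f"] that by (simp add: emeasure_density image_subset_iff)
    have U1: "(\<Union>n::nat. {0..(real n + 1)\<^sup>2}) = {0..}"
    proof -
      have "\<exists>n::nat. y \<le> (real n + 1)\<^sup>2" for y
      proof -
        have "y \<le> real (nat \<lceil>y\<rceil>) + 1" by linarith
        also have "\<dots> \<le> (real (nat \<lceil>y\<rceil>) + 1)\<^sup>2" by (simp add: self_le_power)
        finally show ?thesis by blast
      qed
      then show ?thesis by auto
    qed
    have U2: "(\<Union>n::nat. {0<..real n + 1}) = {0<..}"
    proof -
      have "\<exists>n::nat. y \<le> real n + 1" for y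
        by (rule exI[of _ "nat \<lceil>y\<rceil>"]) linarith
      then show ?thesis by auto
    qed
    have "(\<integral>\<^sup>+y. K y * ?w y * indicator {0..} y \<partial>lborel)
        = (SUP n. \<integral>\<^sup>+y. K y * ?w y * indicator {0..(real n + 1)\<^sup>2} y \<partial>lborel)"
      unfolding U1[symmetric] by (rule UN) (auto simp: incseq_def intro: order_trans power_mono)
    also have "\<dots> = (SUP n. \<integral>\<^sup>+z. 2 * K (z\<^sup>2) * indicator {0<..real n + 1} z \<partial>lborel)"
      by (simp only: 1)
    also have "\<dots> = (\<integral>\<^sup>+z. 2 * K (z\<^sup>2) * indicator {0<..} z \<partial>lborel)"
      unfolding U2[symmetric] by (rule UN[symmetric]) (auto simp: incseq_def)
    finally show ?thesis .
  qed
  have "(\<integral>\<^sup>+z. K (z\<^sup>2) \<partial>lborel) = (\<integral>\<^sup>+z. K (z\<^sup>2) * indicator {0<..} z + K (z\<^sup>2) * indicator {0<..} (0 - z) \<partial>lborel)"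
    by (rule nn_integral_cong_AE, use AE_lborel_singleton[of 0] in eventually_elim) (auto simp: indicator_def)
  also have "\<dots> = (\<integral>\<^sup>+z. K (z\<^sup>2) * indicator {0<..} z \<partial>lborel) + (\<integral>\<^sup>+z. K (z\<^sup>2) * indicator {0<..} (0 - z) \<partial>lborel)"
    by (rule nn_integral_add) measurable
  also have "(\<integral>\<^sup>+z. K (z\<^sup>2) * indicator {0<..} (0 - z) \<partial>lborel) = (\<integral>\<^sup>+z. K (z\<^sup>2) * indicator {0<..} z \<partial>lborel)"
    using nn_integral_lborel_reflect[of "\<lambda>z. K (z\<^sup>2) * indicator {0<..} z" 0] by simp
  also have "(\<integral>\<^sup>+z. K (z\<^sup>2) * indicator {0<..} z \<partial>lborel) + (\<integral>\<^sup>+z. K (z\<^sup>2) * indicator {0<..} z \<partial>lborel)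
      = (\<integral>\<^sup>+z. 2 * K (z\<^sup>2) * indicator {0<..} z \<partial>lborel)"
    by (simp add: nn_integral_cmult mult.assoc flip: mult_2)
  also have "\<dots> = (\<integral>\<^sup>+y. K y * ?w y * indicator {0..} y \<partial>lborel)"
    by (rule half[symmetric])
  also have "\<dots> = (\<integral>\<^sup>+y. K y * ?w y \<partial>lborel)"
    by (rule nn_integral_cong) (auto simp: indicator_def)
  finally show ?thesis .
qed

section \<open>The multivariate normal distribution\<close>

text \<open>Gram-Schmidt for the inner product given by \<open>V\<close>: fewer than
  \<open>CARD('d)\<close> vectors \<open>V *v b i\<close> leave a nonzero \<open>x\<close>
  orthogonal to all of them, and \<open>x\<close> is scaled to \<open>V\<close>-length one.\<close>

lemma exists_conjugate_basis:
  fixes V :: "real^'d^'d"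
  assumes V: "pos_def_mat V" and "finite (I :: 'd set)"
  shows "\<exists>b. \<forall>i\<in>I. \<forall>j\<in>I. b i \<bullet> (V *v b j) = of_bool (i = j)"
  using \<open>finite I\<close>
proof (induction I rule: finite_induct)
  case (insert k I)
  then obtain b where b: "\<forall>i\<in>I. \<forall>j\<in>I. b i \<bullet> (V *v b j) = of_bool (i = j)" by blast
  have sym: "x \<bullet> (V *v y) = y \<bullet> (V *v x)" for x y
    using V unfolding pos_def_mat_def by (metis dot_lmul_matrix inner_commute transpose_matrix_vector)
  let ?S = "(\<lambda>i. V *v b i) ` I"
  have "dim (span ?S) < DIM(real^'d)"
  proof -
    have "dim (span ?S) \<le> card ?S" by (simp add: dim_le_card' insert.hyps(1))
    also have "\<dots> \<le> card I" by (rule card_image_le[OF insert.hyps(1)])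
    also have "\<dots> < CARD('d)" using insert.hyps by (intro psubset_card_mono) auto
    finally show ?thesis by simp
  qed
  then obtain x where x: "x \<noteq> 0" "\<And>y. y \<in> span ?S \<Longrightarrow> orthogonal x y"
    using orthogonal_to_subspace_exists[of ?S] by (metis dim_span)
  define r where "r = sqrt (x \<bullet> (V *v x))"
  have pos: "0 < x \<bullet> (V *v x)" using V x(1) by (simp add: pos_def_mat_def)
  have r: "0 < r" "r * r = x \<bullet> (V *v x)" using pos by (auto simp: r_def)
  define b' where "b' = b(k := x /\<^sub>R r)"
  have ort: "x \<bullet> (V *v b i) = 0" if "i \<in> I" for i
    using x(2)[of "V *v b i"] that by (auto simp: orthogonal_def span_base)
  have "b' i \<bullet> (V *v b' j) = of_bool (i = j)" if "i \<in> insert k I" "j \<in> insert k I" for i j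
  proof (cases "i = k"; cases "j = k")
    assume "i = k" "j = k"
    then show ?thesis using r pos by (simp add: b'_def matrix_vector_mult_scaleR field_simps)
  next
    assume "i = k" "j \<noteq> k"
    then show ?thesis using ort that by (auto simp: b'_def)
  next
    assume "i \<noteq> k" "j = k"
    then show ?thesis using ort[of i] that sym[of "b i" x] by (auto simp: b'_def matrix_vector_mult_scaleR)
  next
    assume "i \<noteq> k" "j \<noteq> k"
    then show ?thesis using b that by (auto simp: b'_def)
  qed
  then show ?case by blast
qed simp

text \<open>The columns of \<open>P\<close> form a \<open>V\<close>-orthonormal basis;
  \<open>P\<close> takes over the role of an inverse square root of \<open>V\<close>.\<close>

lemma pos_def_mat_congruent_mat_1:
  fixes V :: "real^'d^'d"
  assumes V: "pos_def_mat V"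
  obtains P :: "real^'d^'d" where "transpose P ** V ** P = mat 1"
proof -
  obtain b :: "'d \<Rightarrow> real^'d" where b: "\<And>i j. b i \<bullet> (V *v b j) = of_bool (i = j)"
    using exists_conjugate_basis[OF V, of UNIV] by (metis UNIV_I finite)
  define P where "P = (\<chi> i j. b j $ i)"
  have "(transpose P ** (V ** P)) $ i $ j = mat 1 $ i $ j" for i j
    using b[of i j] by (simp add: P_def matrix_matrix_mult_def transpose_def matrix_vector_mult_def inner_vec_def mat_def)
  then have "transpose P ** V ** P = mat 1"
    by (simp add: vec_eq_iff matrix_mul_assoc)
  then show thesis by (rule that)
qed

lemma nn_integral_exp_neg_norm:
  "(\<integral>\<^sup>+x. ennreal (exp (- ((x::'a::euclidean_space) \<bullet> x) / 2)) \<partial>lborel) = ennreal (sqrt (2 * pi) ^ DIM('a))"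
proof -
  have 1: "(\<integral>\<^sup>+x. ennreal (exp (- (x * x :: real) / 2)) \<partial>lborel) = ennreal (sqrt (2 * pi))"
  proof -
    have "(\<integral>\<^sup>+x. ennreal (exp (- (x * x :: real) / 2)) \<partial>lborel) =
        (\<integral>\<^sup>+x. ennreal (sqrt (2 * pi)) * ennreal (normal_density 0 1 x) \<partial>lborel)"
      by (intro nn_integral_cong) (simp add: normal_density_def ennreal_mult[symmetric] power2_eq_square)
    also have "\<dots> = ennreal (sqrt (2 * pi)) * (\<integral>\<^sup>+x. ennreal (normal_density 0 1 x) \<partial>lborel)"
      by (rule nn_integral_cmult) simp
    also have "(\<integral>\<^sup>+x. ennreal (normal_density 0 1 x) \<partial>lborel) = 1"
      using prob_space.emeasure_space_1[OF prob_space_normal_density[of 1 0]] by (simp add: emeasure_density)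
    finally show ?thesis by simp
  qed
  have "(\<integral>\<^sup>+x. ennreal (exp (- ((x::'a) \<bullet> x) / 2)) \<partial>lborel)
      = (\<integral>\<^sup>+x. (\<Prod>b\<in>Basis. ennreal (exp (- (((x::'a) \<bullet> b) * (x \<bullet> b)) / 2))) \<partial>lborel)"
    by (intro nn_integral_cong)
      (simp add: prod_ennreal exp_sum[symmetric] euclidean_inner[of x x for x] sum_negf sum_divide_distrib)
  also have "\<dots> = (\<Prod>b\<in>(Basis::'a set). \<integral>\<^sup>+x. ennreal (exp (- (x * x) / 2)) \<partial>lborel)"
    by (rule nn_integral_lborel_prod[where f = "\<lambda>b x. ennreal (exp (- (x * x) / 2))"]) auto
  also have "\<dots> = ennreal (sqrt (2 * pi) ^ DIM('a))"
    unfolding 1 by (simp add: ennreal_power)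
  finally show ?thesis .
qed

lemma borel_measurable_mvn_density [measurable]: "mvn_density V \<in> borel_measurable borel"
  unfolding mvn_density_def[abs_def] divide_inverse
  by (intro borel_measurable_continuous_onI continuous_intros)

lemma matrix_inv_unique:
  assumes "(A::real^'d^'d) ** B = mat 1"
  shows "matrix_inv A = B"
proof -
  have "B ** A = mat 1" using assms by (metis matrix_left_right_inverse)
  then have "A ** matrix_inv A = mat 1"
    unfolding matrix_inv_def using someI[of "\<lambda>A'. A ** A' = mat 1 \<and> A' ** A = mat 1" B] assms by blast
  then show ?thesis
    using \<open>B ** A = mat 1\<close> by (metis matrix_mul_assoc matrix_mul_lid matrix_mul_rid)
qed

lemma pos_def_mat_det_pos:
  assumes V: "pos_def_mat (V :: real^'d^'d)"
  shows "0 < det V"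
proof -
  obtain P :: "real^'d^'d" where P: "transpose P ** V ** P = mat 1" using pos_def_mat_congruent_mat_1[OF V] .
  have "det P * det V * det P = 1"
    using arg_cong[OF P, of det] by (simp add: det_mul det_transpose)
  then have "(det P)\<^sup>2 * det V = 1" by (simp add: power2_eq_square mult_ac)
  then have "0 < (det P)\<^sup>2 * det V" "0 < (det P)\<^sup>2" by auto
  then show ?thesis by (rule zero_less_mult_pos)
qed

text \<open>Since \<open>matrix_inv V = P ** transpose P\<close>, the quadratic form is the squared
  norm of \<open>transpose P *v x\<close>. A linear change of variables reduces to the standard
  Gaussian, with Jacobian \<open>\<bar>det P\<bar> = 1 / sqrt (det V)\<close>.\<close>

lemma prob_space_mvn:
  fixes V :: "real^'d^'d"
  assumes V: "pos_def_mat V"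
  shows "prob_space (mvn V)"
proof
  obtain P :: "real^'d^'d" where P: "transpose P ** V ** P = mat 1" using pos_def_mat_congruent_mat_1[OF V] .
  then have "V ** P ** transpose P = mat 1"
    using matrix_left_right_inverse[of "transpose P" "V ** P"] by (simp add: matrix_mul_assoc)
  then have U: "matrix_inv V = P ** transpose P"
    by (intro matrix_inv_unique) (simp add: matrix_mul_assoc)
  have d: "det P * det V * det P = 1"
    using arg_cong[OF P, of det] by (simp add: det_mul det_transpose)
  then have d0: "det P \<noteq> 0" by auto
  have dV: "(det P)\<^sup>2 * det V = 1" using d by (simp add: power2_eq_square mult_ac)
  have dV0: "0 < det V" using V by (rule pos_def_mat_det_pos)
  have q: "x \<bullet> (matrix_inv V *v x) = (transpose P *v x) \<bullet> (transpose P *v x)" for x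
    unfolding U by (metis dot_lmul_matrix matrix_vector_mul_assoc transpose_matrix_vector)
  have "emeasure (mvn V) (space (mvn V)) = (\<integral>\<^sup>+x. ennreal (mvn_density V x) \<partial>lborel)"
    by (simp add: mvn_def emeasure_density)
  also have "\<dots> = (\<integral>\<^sup>+x. ennreal (1 / sqrt ((2 * pi) ^ CARD('d) * det V)) *
       ennreal (exp (- ((transpose P *v x) \<bullet> (transpose P *v x)) / 2)) \<partial>lborel)"
    unfolding mvn_density_def q by (intro nn_integral_cong) (subst ennreal_mult'[symmetric], use dV0 in simp_all)
  also have "\<dots> = ennreal (1 / sqrt ((2 * pi) ^ CARD('d) * det V)) *
      (\<integral>\<^sup>+x. ennreal (exp (- ((transpose P *v x) \<bullet> (transpose P *v x)) / 2)) \<partial>lborel)"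
    by (rule nn_integral_cmult) measurable
  also have "(\<integral>\<^sup>+x. ennreal (exp (- ((transpose P *v x) \<bullet> (transpose P *v x)) / 2)) \<partial>lborel)
      = ennreal (sqrt (2 * pi) ^ CARD('d) / \<bar>det P\<bar>)"
  proof -
    let ?J = "(\<integral>\<^sup>+x. ennreal (exp (- ((transpose P *v x) \<bullet> (transpose P *v x)) / 2)) \<partial>lborel)"
    have "ennreal \<bar>det P\<bar> * ?J = ennreal (sqrt (2 * pi) ^ CARD('d))"
      using nn_integral_lborel_matrix[of "\<lambda>x. ennreal (exp (- (x \<bullet> x) / 2))" "transpose P"] d0
        nn_integral_exp_neg_norm[where 'a = "real^'d"] by (simp add: det_transpose)
    then have "ennreal (1 / \<bar>det P\<bar>) * (ennreal \<bar>det P\<bar> * ?J) = ennreal (sqrt (2 * pi) ^ CARD('d) / \<bar>det P\<bar>)"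
      by (simp add: ennreal_mult'[symmetric])
    moreover have "ennreal (1 / \<bar>det P\<bar>) * ennreal \<bar>det P\<bar> = 1"
      using d0 by (simp add: ennreal_mult[symmetric])
    ultimately show ?thesis by (simp add: mult.assoc[symmetric])
  qed
  also have "ennreal (1 / sqrt ((2 * pi) ^ CARD('d) * det V)) * ennreal (sqrt (2 * pi) ^ CARD('d) / \<bar>det P\<bar>) = 1"
  proof -
    have "sqrt (det V) * \<bar>det P\<bar> = sqrt ((det P)\<^sup>2 * det V)"
      by (simp add: real_sqrt_mult mult.commute)
    then have "sqrt (det V) * \<bar>det P\<bar> = 1" by (simp add: dV)
    then have "1 / sqrt ((2 * pi) ^ CARD('d) * det V) * (sqrt (2 * pi) ^ CARD('d) / \<bar>det P\<bar>) = 1"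
    proof -
      have "sqrt ((2 * pi) ^ CARD('d) * det V) = sqrt (2 * pi) ^ CARD('d) * sqrt (det V)"
        by (simp only: real_sqrt_mult real_sqrt_power)
      moreover have "sqrt (2 * pi) ^ CARD('d) \<noteq> 0" by simp
      moreover have "1 / (x * y) * (x / z) = 1" if "y * z = 1" "x \<noteq> 0" for x y z :: real
        using that by (auto simp: field_simps)
      ultimately show ?thesis using \<open>sqrt (det V) * \<bar>det P\<bar> = 1\<close> by metis
    qed
    then show ?thesis by (simp add: ennreal_mult''[symmetric])
  qed
  finally show "emeasure (mvn V) (space (mvn V)) = 1" .
qed

section \<open>The Wishart distribution as an image measure of square matrices\<close>

lemma borel_measurable_matrix_mult [measurable]:
  fixes f :: "'a \<Rightarrow> real^'n^'m" and g :: "'a \<Rightarrow> real^'k^'n"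
  assumes "f \<in> borel_measurable M" "g \<in> borel_measurable M"
  shows "(\<lambda>x. f x ** g x) \<in> borel_measurable M"
proof (rule borel_measurable_continuous_Pair[OF assms])
  show "continuous_on UNIV (\<lambda>p. fst p ** snd p :: real^'k^'m)"
    unfolding matrix_matrix_mult_def by (intro continuous_intros)
qed

text \<open>The coefficient is \<open>(r - 1) / s\<close> with \<open>s = y \<bullet> y\<close> and \<open>r\<^sup>2 = 1 + s\<close>, written so that it makes sense for \<open>y = 0\<close>;
  it makes the square of this matrix equal to \<open>I + y y\<^sup>T\<close>.\<close>

definition sqrt_id_plus_outer :: "real^'d \<Rightarrow> real^'d^'d" where
  "sqrt_id_plus_outer y = mat 1 + (1 / (1 + sqrt (1 + y \<bullet> y))) *\<^sub>R outer y"

lemma borel_measurable_sqrt_id_plus_outer [measurable]: "sqrt_id_plus_outer \<in> borel_measurable borel"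
  unfolding sqrt_id_plus_outer_def[abs_def] by measurable

lemma outer_mult_vec: "outer y *v x = (y \<bullet> x) *\<^sub>R y"
  by (simp add: vec_eq_iff outer_def matrix_vector_mult_def inner_vec_def sum_distrib_left sum_distrib_right mult_ac)

text \<open>The matrix is positive definite: its quadratic form at \<open>x\<close> is
  \<open>x \<bullet> x\<close> plus a nonnegative multiple of
  \<open>(x \<bullet> y)^2\<close>.\<close>

lemma det_sqrt_id_plus_outer: "det (sqrt_id_plus_outer y) \<noteq> 0"
proof
  let ?c = "1 / (1 + sqrt (1 + y \<bullet> y))"
  assume "det (sqrt_id_plus_outer y) = 0"
  then obtain x where x: "x \<noteq> 0" "sqrt_id_plus_outer y *v x = 0"
    by (metis invertible_det_nz invertible_left_inverse matrix_left_invertible_ker)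
  have "0 = x \<bullet> (sqrt_id_plus_outer y *v x)" using x by simp
  also have "\<dots> = x \<bullet> x + ?c * (x \<bullet> y)\<^sup>2"
    by (simp add: sqrt_id_plus_outer_def matrix_vector_mult_add_rdistrib scaleR_matrix_vector_assoc[symmetric]
        outer_mult_vec inner_add_right inner_commute power2_eq_square)
  finally have "x \<bullet> x + ?c * (x \<bullet> y)\<^sup>2 = 0" by simp
  moreover have "0 \<le> ?c * (x \<bullet> y)\<^sup>2" by (simp add: add_nonneg_nonneg)
  moreover have "0 < x \<bullet> x" using x by simp
  ultimately show False by linarith
qed

lemma gram_sqrt_id_plus_outer:
  "gram (sqrt_id_plus_outer y ** G) = gram G + outer (transpose G *v y)"
proof -
  let ?R = "sqrt_id_plus_outer y"
  define s where "s = y \<bullet> y"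
  define c where "c = 1 / (1 + sqrt (1 + s))"
  have s: "0 \<le> s" by (simp add: s_def)
  have R: "?R = mat 1 + c *\<^sub>R outer y" by (simp add: sqrt_id_plus_outer_def c_def s_def)
  have oo: "outer y ** outer y = s *\<^sub>R outer y"
    by (simp add: vec_eq_iff outer_def matrix_matrix_mult_def s_def inner_vec_def sum_distrib_left sum_distrib_right mult_ac)
  \<comment> \<open>The coefficient of \<open>outer y\<close> in the square of the matrix. With
    \<open>r = sqrt (1 + s)\<close> one has \<open>c * s = r - 1\<close>, so the sum collapses to
    \<open>c * (r + 1) = 1\<close>.\<close>
  have c: "c + (c + c * (c * s)) = 1"
  proof -
    define r where "r = sqrt (1 + s)"
    have r: "r * r = 1 + s" "0 \<le> r" using s by (auto simp: r_def)
    have "s = (r - 1) * (r + 1)" using r by (simp add: algebra_simps)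
    then have cs: "c * s = r - 1" using r by (simp add: c_def r_def[symmetric] field_simps)
    have "c * (r + 1) = 1" using r by (simp add: c_def r_def[symmetric] field_simps)
    then show ?thesis unfolding cs by (simp add: algebra_simps)
  qed
  have "?R ** ?R = mat 1 + (c + (c + c * (c * s))) *\<^sub>R outer y"
    unfolding R by (simp add: matrix_add_ldistrib matrix_add_rdistrib matrix_scalar_ac oo flip: scalar_matrix_assoc)
      (simp add: vec_eq_iff algebra_simps)
  then have RR: "?R ** ?R = mat 1 + outer y" using c by simp
  have T: "transpose ?R = ?R"
    by (simp add: R vec_eq_iff transpose_def outer_def mat_def mult.commute)
  have "gram (?R ** G) = transpose G ** (transpose ?R ** ?R) ** G"
    by (simp add: gram_def matrix_transpose_mul matrix_mul_assoc)
  also have "\<dots> = gram G + transpose G ** outer y ** G"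
    unfolding T RR by (simp add: gram_def matrix_add_ldistrib matrix_add_rdistrib)
  also have "transpose G ** outer y ** G = outer (transpose G *v y)"
    using matrix_mult_outer[of "transpose G" y] by simp
  finally show ?thesis .
qed

text \<open>Substituting \<open>x = transpose G *v y\<close> produces one more factor
  \<open>\<bar>det G\<bar>\<close> and turns the argument of \<open>g\<close> into the Gram matrix
  of \<open>sqrt_id_plus_outer y ** G\<close>. For fixed \<open>y\<close> this is a linear change of
  variables in \<open>G\<close>, whose constant depends on \<open>y\<close> alone. The order of
  quantifiers matters: \<open>\<kappa>\<close> is the same for all \<open>g\<close>.\<close>

lemma nn_integral_gram_add_outer:
  fixes j :: nat
  shows "\<exists>\<kappa>. \<forall>g \<in> borel_measurable borel.
    (\<integral>\<^sup>+x. (\<integral>\<^sup>+G. g (gram (G::real^'d^'d) + outer x) * ennreal (\<bar>det G\<bar> ^ j) \<partial>lborel) \<partial>lborel)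
    = \<kappa> * (\<integral>\<^sup>+G. g (gram (G::real^'d^'d)) * ennreal (\<bar>det G\<bar> ^ Suc j) \<partial>lborel)"
proof -
  let ?R = "sqrt_id_plus_outer :: real^'d \<Rightarrow> _"
  define C :: "real^'d \<Rightarrow> ennreal"
    \<comment> \<open>The first factor is the volume constant of left multiplication by
      \<open>?R y\<close>, the second undoes its effect on
      \<open>\<bar>det G\<bar> ^ Suc j\<close>.\<close>
    where "C y = (\<integral>\<^sup>+G. indicator (cbox 0 One) (- (?R y ** (G::real^'d^'d))) \<partial>lborel) * ennreal ((1 / \<bar>det (?R y)\<bar>) ^ Suc j)" for y
  have [measurable]: "C \<in> borel_measurable borel"
    unfolding C_def[abs_def] by measurable
  show ?thesis
  proof (intro exI ballI)
    fix g :: "real^'d^'d \<Rightarrow> ennreal"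
    assume [measurable]: "g \<in> borel_measurable borel"
    let ?h = "\<lambda>G::real^'d^'d. g (gram G) * ennreal (\<bar>det G\<bar> ^ Suc j)"
    have "(\<integral>\<^sup>+x. (\<integral>\<^sup>+G. g (gram (G::real^'d^'d) + outer x) * ennreal (\<bar>det G\<bar> ^ j) \<partial>lborel) \<partial>lborel)
      = (\<integral>\<^sup>+G. (\<integral>\<^sup>+x. g (gram (G::real^'d^'d) + outer x) * ennreal (\<bar>det G\<bar> ^ j) \<partial>lborel) \<partial>lborel)"
      by (rule lborel_pair.Fubini') measurable
    also have "\<dots> = (\<integral>\<^sup>+G. (\<integral>\<^sup>+y. g (gram (?R y ** G)) * ennreal (\<bar>det G\<bar> ^ Suc j) \<partial>lborel) \<partial>lborel)"
    proof (rule nn_integral_cong_AE, use AE_det_nonzero in eventually_elim)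
      fix G :: "real^'d^'d"
      assume G: "det G \<noteq> 0"
      have "(\<integral>\<^sup>+x. g (gram G + outer x) * ennreal (\<bar>det G\<bar> ^ j) \<partial>lborel)
         = (\<integral>\<^sup>+x. g (gram G + outer x) \<partial>lborel) * ennreal (\<bar>det G\<bar> ^ j)"
        by (rule nn_integral_multc) measurable
      also have "(\<integral>\<^sup>+x. g (gram G + outer x) \<partial>lborel)
          = ennreal \<bar>det G\<bar> * (\<integral>\<^sup>+y. g (gram (?R y ** G)) \<partial>lborel)"
        using nn_integral_lborel_matrix[of "\<lambda>x. g (gram G + outer x)" "transpose G"] G
        by (simp add: det_transpose gram_sqrt_id_plus_outer)
      also have "\<dots> * ennreal (\<bar>det G\<bar> ^ j) = (\<integral>\<^sup>+y. g (gram (?R y ** G)) \<partial>lborel) * ennreal (\<bar>det G\<bar> ^ Suc j)"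
        by (simp add: ennreal_mult mult_ac)
      also have "\<dots> = (\<integral>\<^sup>+y. g (gram (?R y ** G)) * ennreal (\<bar>det G\<bar> ^ Suc j) \<partial>lborel)"
        by (rule nn_integral_multc[symmetric]) measurable
      finally show "(\<integral>\<^sup>+x. g (gram G + outer x) * ennreal (\<bar>det G\<bar> ^ j) \<partial>lborel)
         = (\<integral>\<^sup>+y. g (gram (?R y ** G)) * ennreal (\<bar>det G\<bar> ^ Suc j) \<partial>lborel)" .
    qed
    also have "\<dots> = (\<integral>\<^sup>+y. (\<integral>\<^sup>+G. g (gram (?R y ** G)) * ennreal (\<bar>det G\<bar> ^ Suc j) \<partial>lborel) \<partial>lborel)"
      by (rule lborel_pair.Fubini') measurable
    also have "\<dots> = (\<integral>\<^sup>+y. C y * (\<integral>\<^sup>+G. ?h G \<partial>lborel) \<partial>lborel)"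
    proof (rule nn_integral_cong)
      fix y :: "real^'d"
      have d0: "det (?R y) \<noteq> 0" by (rule det_sqrt_id_plus_outer)
      have surj: "surj (\<lambda>G::real^'d^'d. ?R y ** G)"
      proof -
        obtain R' where "?R y ** R' = mat 1"
          using d0 by (metis invertible_det_nz invertible_def)
        then have "G = ?R y ** (R' ** G)" for G :: "real^'d^'d" by (simp add: matrix_mul_assoc)
        then show ?thesis by (rule surjI[of _ "\<lambda>G. R' ** G", OF sym])
      qed
      have lin: "linear (\<lambda>G::real^'d^'d. ?R y ** G)"
        by (intro linearI) (simp_all add: matrix_add_ldistrib matrix_scalar_ac scalar_matrix_assoc)
      have "g (gram (?R y ** G)) * ennreal (\<bar>det G\<bar> ^ Suc j)
          = ennreal ((1 / \<bar>det (?R y)\<bar>) ^ Suc j) * ?h (?R y ** G)" for G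
      proof -
        have "\<bar>det G\<bar> ^ Suc j = (1 / \<bar>det (?R y)\<bar>) ^ Suc j * \<bar>det (?R y ** G)\<bar> ^ Suc j"
          unfolding power_mult_distrib[symmetric] using d0 by (simp add: det_mul abs_mult)
        then have "ennreal (\<bar>det G\<bar> ^ Suc j) = ennreal ((1 / \<bar>det (?R y)\<bar>) ^ Suc j) * ennreal (\<bar>det (?R y ** G)\<bar> ^ Suc j)"
          by (simp only:) (rule ennreal_mult, simp_all)
        then show ?thesis
          by (simp only: mult_ac)
      qed
      then have "(\<integral>\<^sup>+G. g (gram (?R y ** G)) * ennreal (\<bar>det G\<bar> ^ Suc j) \<partial>lborel)
         = (\<integral>\<^sup>+G. ennreal ((1 / \<bar>det (?R y)\<bar>) ^ Suc j) * ?h (?R y ** G) \<partial>lborel)"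
        by simp
      also have "\<dots> = ennreal ((1 / \<bar>det (?R y)\<bar>) ^ Suc j) * (\<integral>\<^sup>+G. ?h (?R y ** G) \<partial>lborel)"
        by (rule nn_integral_cmult) measurable
      also have "(\<integral>\<^sup>+G. ?h (?R y ** G) \<partial>lborel) =
          (\<integral>\<^sup>+G. indicator (cbox 0 One) (- (?R y ** (G::real^'d^'d))) \<partial>lborel) * (\<integral>\<^sup>+G. ?h G \<partial>lborel)"
        by (rule nn_integral_lborel_linear[OF _ lin surj]) measurable
      finally show "(\<integral>\<^sup>+G. g (gram (?R y ** G)) * ennreal (\<bar>det G\<bar> ^ Suc j) \<partial>lborel)
         = C y * (\<integral>\<^sup>+G. ?h G \<partial>lborel)"
        by (simp only: C_def mult_ac)
    qed
    also have "\<dots> = (\<integral>\<^sup>+y. C y \<partial>lborel) * (\<integral>\<^sup>+G. ?h G \<partial>lborel)"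
      by (rule nn_integral_multc) measurable
    finally show "(\<integral>\<^sup>+x. (\<integral>\<^sup>+G. g (gram (G::real^'d^'d) + outer x) * ennreal (\<bar>det G\<bar> ^ j) \<partial>lborel) \<partial>lborel)
      = (\<integral>\<^sup>+y. C y \<partial>lborel) * (\<integral>\<^sup>+G. ?h G \<partial>lborel)" .
  qed
qed

section \<open>Wishart integrals as iterated Gaussian integrals\<close>

lemma sets_mvn [measurable_cong, simp]: "sets (mvn V) = sets borel"
  by (simp add: mvn_def)

lemma sets_wishart [measurable_cong, simp]: "sets (wishart V m) = sets borel"
  by (simp add: wishart_def)

lemma prob_space_wishart:
  assumes "pos_def_mat V"
  shows "prob_space (wishart V m)"
proof -
  interpret prob_space "mvn V" using assms by (rule prob_space_mvn)
  interpret product_prob_space "\<lambda>_. mvn V" "{..<m}" by unfold_locales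
  show ?thesis unfolding wishart_def by (rule prob_space.prob_space_distr) (unfold_locales, measurable)
qed

lemma nn_integral_wishart_Suc:
  assumes V: "pos_def_mat V" and [measurable]: "f \<in> borel_measurable borel"
  shows "(\<integral>\<^sup>+M. f M \<partial>wishart V (Suc m)) = (\<integral>\<^sup>+x. ennreal (mvn_density V x) * (\<integral>\<^sup>+M. f (M + outer x) \<partial>wishart V m) \<partial>lborel)"
proof -
  interpret prob_space "mvn V" using V by (rule prob_space_mvn)
  interpret P: product_sigma_finite "\<lambda>_::nat. mvn V" by unfold_locales
  have W: "(\<integral>\<^sup>+M. h M \<partial>wishart V n) = (\<integral>\<^sup>+x. h (\<Sum>i<n. outer (x i)) \<partial>PiM {..<n} (\<lambda>_. mvn V))"
    if [measurable]: "h \<in> borel_measurable borel" for h n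
    unfolding wishart_def by (rule nn_integral_distr) measurable
  have "(\<integral>\<^sup>+M. f M \<partial>wishart V (Suc m)) = (\<integral>\<^sup>+x. f (\<Sum>i<Suc m. outer (x i)) \<partial>PiM (insert m {..<m}) (\<lambda>_. mvn V))"
    unfolding W[OF assms(2)] lessThan_Suc ..
  also have "\<dots> = (\<integral>\<^sup>+y. (\<integral>\<^sup>+x. f (\<Sum>i<Suc m. outer ((x(m := y)) i)) \<partial>PiM {..<m} (\<lambda>_. mvn V)) \<partial>mvn V)"
    unfolding lessThan_Suc by (rule P.product_nn_integral_insert_rev) (simp, simp, measurable)
  also have "\<dots> = (\<integral>\<^sup>+y. (\<integral>\<^sup>+M. f (M + outer y) \<partial>wishart V m) \<partial>mvn V)"
  proof (rule nn_integral_cong)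
    fix y
    have "(\<Sum>i<Suc m. outer ((x(m := y)) i)) = (\<Sum>i<m. outer (x i)) + outer y" for x :: "nat \<Rightarrow> real^'a"
      by (simp add: sum.lessThan_Suc)
    then show "(\<integral>\<^sup>+x. f (\<Sum>i<Suc m. outer ((x(m := y)) i)) \<partial>PiM {..<m} (\<lambda>_. mvn V)) = (\<integral>\<^sup>+M. f (M + outer y) \<partial>wishart V m)"
      by (simp add: W)
  qed
  also have "\<dots> = (\<integral>\<^sup>+x. ennreal (mvn_density V x) * (\<integral>\<^sup>+M. f (M + outer x) \<partial>wishart V m) \<partial>lborel)"
  proof -
    interpret w: prob_space "wishart V m" using V by (rule prob_space_wishart)
    have [measurable]: "(\<lambda>x. \<integral>\<^sup>+M. f (M + outer x) \<partial>wishart V m) \<in> borel_measurable borel"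
      by measurable
    show ?thesis
      unfolding mvn_def by (subst nn_integral_density) auto
  qed
  finally show ?thesis .
qed

section \<open>Product densities, and matrices as tuples of rows\<close>

lemma nn_integral_PiM_density:
  fixes \<phi> :: "'a::euclidean_space \<Rightarrow> ennreal"
  assumes [measurable]: "\<phi> \<in> borel_measurable borel" and sf: "sigma_finite_measure (density lborel \<phi>)"
    and "finite I" and "f \<in> borel_measurable (PiM I (\<lambda>_. lborel))"
  shows "(\<integral>\<^sup>+x. f x \<partial>PiM I (\<lambda>_. density lborel \<phi>)) = (\<integral>\<^sup>+x. f x * (\<Prod>i\<in>I. \<phi> (x i)) \<partial>PiM I (\<lambda>_. lborel))"
  using \<open>finite I\<close> assms(4)
proof (induction I arbitrary: f rule: finite_induct)
  case empty
  then show ?case by (simp add: PiM_empty nn_integral_count_space_finite)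
next
  case (insert i I)
  interpret D: product_sigma_finite "\<lambda>_. density lborel \<phi>" using sf by (simp add: product_sigma_finite_def)
  interpret L: product_sigma_finite "\<lambda>_. lborel :: 'a measure" by unfold_locales
  interpret LI: sigma_finite_measure "PiM I (\<lambda>_. lborel :: 'a measure)"
    by (rule L.sigma_finite) (rule insert.hyps)
  have sets: "sets (PiM J (\<lambda>_. density lborel \<phi>)) = sets (PiM J (\<lambda>_. lborel))" for J
    by (rule sets_PiM_cong) auto
  note [measurable] = insert.prems
  have f: "f \<in> borel_measurable (PiM (insert i I) (\<lambda>_. density lborel \<phi>))"
    using insert.prems by (simp add: measurable_cong_sets[OF sets refl])
  have upd[measurable]: "(\<lambda>p. f ((snd p)(i := fst p))) \<in> borel_measurable (lborel \<Otimes>\<^sub>M PiM I (\<lambda>_. lborel))"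
    by measurable
  have "(\<integral>\<^sup>+x. f x \<partial>PiM (insert i I) (\<lambda>_. density lborel \<phi>))
     = (\<integral>\<^sup>+y. (\<integral>\<^sup>+x. f (x(i := y)) \<partial>PiM I (\<lambda>_. density lborel \<phi>)) \<partial>density lborel \<phi>)"
    by (rule D.product_nn_integral_insert_rev) (use insert.hyps f in auto)
  also have "\<dots> = (\<integral>\<^sup>+y. (\<integral>\<^sup>+x. f (x(i := y)) * (\<Prod>i\<in>I. \<phi> (x i)) \<partial>PiM I (\<lambda>_. lborel)) \<partial>density lborel \<phi>)"
    by (intro nn_integral_cong insert.IH) measurable
  also have "\<dots> = (\<integral>\<^sup>+y. \<phi> y * (\<integral>\<^sup>+x. f (x(i := y)) * (\<Prod>i\<in>I. \<phi> (x i)) \<partial>PiM I (\<lambda>_. lborel)) \<partial>lborel)"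
    by (rule nn_integral_density) measurable
  also have "\<dots> = (\<integral>\<^sup>+y. (\<integral>\<^sup>+x. f (x(i := y)) * (\<Prod>k\<in>insert i I. \<phi> ((x(i := y)) k)) \<partial>PiM I (\<lambda>_. lborel)) \<partial>lborel)"
  proof (rule nn_integral_cong)
    fix y
    have "(\<Prod>k\<in>insert i I. \<phi> ((x(i := y)) k)) = \<phi> y * (\<Prod>i\<in>I. \<phi> (x i))" for x
    proof -
      have "(\<Prod>k\<in>I. \<phi> ((x(i := y)) k)) = (\<Prod>i\<in>I. \<phi> (x i))"
        by (rule prod.cong) (use insert.hyps in auto)
      then show ?thesis using insert.hyps by simp
    qed
    then have "(\<integral>\<^sup>+x. f (x(i := y)) * (\<Prod>k\<in>insert i I. \<phi> ((x(i := y)) k)) \<partial>PiM I (\<lambda>_. lborel))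
       = (\<integral>\<^sup>+x. \<phi> y * (f (x(i := y)) * (\<Prod>i\<in>I. \<phi> (x i))) \<partial>PiM I (\<lambda>_. lborel))"
      by (simp add: mult_ac)
    also have "\<dots> = \<phi> y * (\<integral>\<^sup>+x. f (x(i := y)) * (\<Prod>i\<in>I. \<phi> (x i)) \<partial>PiM I (\<lambda>_. lborel))"
      by (rule nn_integral_cmult) measurable
    finally show "\<phi> y * (\<integral>\<^sup>+x. f (x(i := y)) * (\<Prod>i\<in>I. \<phi> (x i)) \<partial>PiM I (\<lambda>_. lborel)) =
       (\<integral>\<^sup>+x. f (x(i := y)) * (\<Prod>k\<in>insert i I. \<phi> ((x(i := y)) k)) \<partial>PiM I (\<lambda>_. lborel))" by simp
  qed
  also have "\<dots> = (\<integral>\<^sup>+x. f x * (\<Prod>i\<in>insert i I. \<phi> (x i)) \<partial>PiM (insert i I) (\<lambda>_. lborel))"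
    by (rule L.product_nn_integral_insert_rev[symmetric]) (use insert.hyps in \<open>simp, simp, measurable\<close>)
  finally show ?case .
qed

lemma borel_measurable_vec_nth [measurable]:
  "(\<lambda>x::'a::euclidean_space^'n. x $ i) \<in> borel_measurable borel"
  by (intro borel_measurable_continuous_onI continuous_intros)

lemma borel_measurable_rows [measurable]:
  assumes "\<And>i. e i \<in> I"
  shows "(\<lambda>x. \<chi> i::'n::finite. x (e i)) \<in> borel_measurable (PiM I (\<lambda>_. lborel :: 'a::euclidean_space measure))"
proof (subst borel_measurable_euclidean_space, intro ballI)
  fix b :: "'a^'n" assume "b \<in> Basis"
  then obtain i b' where b: "b = axis i b'" by (auto simp: Basis_vec_def)
  have [measurable]: "(\<lambda>x. x (e i)) \<in> borel_measurable (PiM I (\<lambda>_. lborel :: 'a measure))"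
    using measurable_component_singleton[OF assms[of i], of "\<lambda>_. lborel :: 'a measure"] by simp
  show "(\<lambda>x. (\<chi> i. x (e i)) \<bullet> b) \<in> borel_measurable (PiM I (\<lambda>_. lborel :: 'a measure))"
    unfolding b inner_axis by simp
qed

text \<open>Both measures agree on boxes, which are products of boxes for the rows. The bijection
  \<open>e\<close> mediates between samples numbered by naturals and rows indexed by a finite
  type.\<close>

lemma lborel_eq_distr_rows:
  assumes e: "bij_betw e (UNIV :: 'n::finite set) I"
  shows "lborel = distr (PiM I (\<lambda>_. lborel :: 'a::euclidean_space measure)) borel (\<lambda>x. \<chi> i::'n. x (e i))"
proof (rule lborel_eqI)
  have fin: "finite I" using e by (metis bij_betw_finite finite)
  interpret L: product_sigma_finite "\<lambda>_. lborel :: 'a measure" by unfold_locales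
  interpret F: finite_product_sigma_finite "\<lambda>_. lborel :: 'a measure" I by unfold_locales (rule fin)
  have eI: "e i \<in> I" for i using e by (auto simp: bij_betw_def)
  define e' where "e' = inv_into UNIV e"
  have e': "e' (e i) = i" for i
    using e by (simp add: e'_def bij_betw_def)
  have ee': "e (e' k) = k" if "k \<in> I" for k
    using e that by (simp add: e'_def bij_betw_def f_inv_into_f)
  fix l u :: "'a^'n"
  assume lu: "\<And>b. b \<in> Basis \<Longrightarrow> l \<bullet> b \<le> u \<bullet> b"
  have lu': "l $ i \<bullet> b \<le> u $ i \<bullet> b" if "b \<in> Basis" for i b
    using lu[of "axis i b"] that by (simp add: inner_axis axis_in_Basis_iff)
  have box: "x \<in> box l u \<longleftrightarrow> (\<forall>i. x $ i \<in> box (l $ i) (u $ i))" for x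
    by (auto simp: mem_box Basis_vec_def inner_axis)
  have "(\<lambda>x. \<chi> i::'n. x (e i)) -` box l u \<inter> space (PiM I (\<lambda>_. lborel :: 'a measure))
      = PiE I (\<lambda>k. box (l $ e' k) (u $ e' k))"
    using ee' eI by (auto simp: box space_PiM PiE_iff) (metis e' eI)+
  then have "emeasure (distr (PiM I (\<lambda>_. lborel :: 'a measure)) borel (\<lambda>x. \<chi> i::'n. x (e i))) (box l u)
      = emeasure (PiM I (\<lambda>_. lborel :: 'a measure)) (PiE I (\<lambda>k. box (l $ e' k) (u $ e' k)))"
    by (subst emeasure_distr) (auto intro!: borel_measurable_rows eI)
  also have "\<dots> = (\<Prod>k\<in>I. emeasure lborel (box (l $ e' k) (u $ e' k)))"
    by (rule F.measure_times) auto
  also have "\<dots> = (\<Prod>i\<in>UNIV. emeasure lborel (box (l $ i) (u $ i)))"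
    by (subst prod.reindex_bij_betw[OF e, symmetric]) (simp add: e')
  also have "\<dots> = (\<Prod>i\<in>UNIV. ennreal (\<Prod>b\<in>Basis. (u $ i - l $ i) \<bullet> b))"
    by (intro prod.cong refl) (simp add: lu')
  also have "\<dots> = ennreal (\<Prod>i\<in>UNIV. \<Prod>b\<in>Basis. (u $ i - l $ i) \<bullet> b)"
    by (rule prod_ennreal) (auto intro!: prod_nonneg simp: inner_diff_left lu')
  also have "(\<Prod>i\<in>UNIV. \<Prod>b\<in>Basis. (u $ i - l $ i) \<bullet> b) = (\<Prod>b\<in>Basis. (u - l) \<bullet> b)"
  proof -
    have B: "(Basis :: ('a^'n) set) = (\<lambda>(i, b). axis i b) ` (UNIV \<times> Basis)"
      by (auto simp: Basis_vec_def)
    have inj: "inj_on (\<lambda>(i::'n, b::'a). axis i b) (UNIV \<times> Basis)"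
      by (auto simp: inj_on_def axis_eq_axis)
    show ?thesis
      unfolding B prod.reindex[OF inj] prod.cartesian_product
      by (intro prod.cong) (auto simp: inner_axis)
  qed
  finally show "emeasure (distr (PiM I (\<lambda>_. lborel :: 'a measure)) borel (\<lambda>x. \<chi> i::'n. x (e i))) (box l u)
      = ennreal (\<Prod>b\<in>Basis. (u - l) \<bullet> b)" .
qed simp

section \<open>The Wishart weight on Gram matrices\<close>

lemma gram_eq_sum_outer: "gram G = (\<Sum>i\<in>UNIV. outer (G $ i))"
  by (simp add: vec_eq_iff gram_nth outer_def)

lemma inner_outer: "U \<bullet> outer x = x \<bullet> (U *v x)"
  by (simp add: outer_def inner_vec_def matrix_vector_mult_def sum_distrib_left mult_ac)

text \<open>A weight relative to the image of Lebesgue measure under \<open>gram\<close>, not a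
  Lebesgue density in \<open>M\<close>. The entrywise inner product \<open>U \<bullet> M\<close> is
  the trace of \<open>U M\<close> for symmetric \<open>U\<close>, and the square root makes
  \<open>\<bar>det G\<bar>\<close> appear at \<open>M = gram G\<close>.\<close>

definition wishart_weight :: "real^'d^'d \<Rightarrow> nat \<Rightarrow> real^'d^'d \<Rightarrow> real" where
  "wishart_weight U j M = sqrt (det M) ^ j * exp (- (U \<bullet> M) / 2)"

lemma borel_measurable_wishart_weight [measurable]: "wishart_weight U j \<in> borel_measurable borel"
  unfolding wishart_weight_def[abs_def] by measurable

lemma wishart_weight_gram: "wishart_weight U j (gram G) = \<bar>det G\<bar> ^ j * exp (- (U \<bullet> gram G) / 2)"
  by (simp add: wishart_weight_def det_gram)

text \<open>With exactly \<open>CARD('d)\<close> samples, stacking them as rows gives a square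
  matrix \<open>G\<close> whose Gram matrix is the sum of the outer products, and the Gaussian
  densities multiply to an exponential of \<open>gram G\<close>.\<close>

lemma nn_integral_wishart_square:
  fixes V :: "real^'d^'d"
  assumes V: "pos_def_mat V"
  shows "\<exists>\<kappa>. \<forall>f\<in>borel_measurable borel.
    (\<integral>\<^sup>+M. f M \<partial>wishart V (CARD('d))) = \<kappa> * (\<integral>\<^sup>+G. f (gram (G::real^'d^'d)) * ennreal (exp (- (matrix_inv V \<bullet> gram G) / 2)) \<partial>lborel)"
proof (intro exI ballI)
  fix f :: "real^'d^'d \<Rightarrow> ennreal"
  assume [measurable]: "f \<in> borel_measurable borel"
  let ?n = "CARD('d)"
  let ?K = "sqrt ((2 * pi) ^ CARD('d) * det V)"
  obtain e :: "'d \<Rightarrow> nat" where e: "bij_betw e UNIV {..<?n}"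
    using ex_bij_betw_finite_nat[of "UNIV :: 'd set"] by (auto simp: atLeast0LessThan)
  let ?\<phi> = "\<lambda>x. ennreal (mvn_density V x)"
  interpret prob_space "mvn V" using V by (rule prob_space_mvn)
  let ?L = "PiM {..<?n} (\<lambda>_. lborel :: (real^'d) measure)"
  have eI: "e i < ?n" for i using e by (auto simp: bij_betw_def)
  have "(\<integral>\<^sup>+M. f M \<partial>wishart V ?n) = (\<integral>\<^sup>+x. f (\<Sum>i<?n. outer (x i)) \<partial>PiM {..<?n} (\<lambda>_. mvn V))"
    unfolding wishart_def by (rule nn_integral_distr) measurable
  also have "\<dots> = (\<integral>\<^sup>+x. f (\<Sum>i<?n. outer (x i)) * (\<Prod>i<?n. ?\<phi> (x i)) \<partial>?L)"
    unfolding mvn_def by (rule nn_integral_PiM_density) (use sigma_finite_measure_axioms in \<open>simp_all add: mvn_def\<close>)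
  also have "\<dots> = (\<integral>\<^sup>+x. f (gram (\<chi> i. x (e i))) * (\<Prod>i\<in>UNIV. ?\<phi> ((\<chi> i. x (e i)) $ i)) \<partial>?L)"
    by (simp add: gram_eq_sum_outer sum.reindex_bij_betw[OF e, of "\<lambda>k. outer (x k)" for x]
        prod.reindex_bij_betw[OF e, of "\<lambda>k. ?\<phi> (x k)" for x])
  also have "\<dots> = (\<integral>\<^sup>+G. f (gram G) * (\<Prod>i\<in>UNIV. ?\<phi> (G $ i)) \<partial>distr ?L borel (\<lambda>x. \<chi> i. x (e i)))"
  proof (rule nn_integral_distr[symmetric])
    show "(\<lambda>x. \<chi> i. x (e i)) \<in> borel_measurable ?L"
      by (rule borel_measurable_rows) (simp add: eI)
    show "(\<lambda>G. f (gram G) * (\<Prod>i\<in>UNIV. ?\<phi> (G $ i))) \<in> borel_measurable (distr ?L borel (\<lambda>x. \<chi> i. x (e i)))"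
      by measurable
  qed
  also have "\<dots> = (\<integral>\<^sup>+G. f (gram (G::real^'d^'d)) * (\<Prod>i\<in>UNIV. ?\<phi> (G $ i)) \<partial>lborel)"
    using lborel_eq_distr_rows[OF e, where 'a = "real^'d"] by simp
  also have "\<dots> = (\<integral>\<^sup>+G. ennreal ((1 / ?K) ^ ?n) * (f (gram (G::real^'d^'d)) * ennreal (exp (- (matrix_inv V \<bullet> gram G) / 2))) \<partial>lborel)"
  proof (rule nn_integral_cong)
    fix G :: "real^'d^'d"
    have K: "0 \<le> ?K" using pos_def_mat_det_pos[OF V] by simp
    have "(\<Prod>i\<in>UNIV. mvn_density V (G $ i)) = (1 / ?K) ^ ?n * (\<Prod>i\<in>UNIV. exp (- (G $ i \<bullet> (matrix_inv V *v G $ i)) / 2))"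
      by (simp add: mvn_density_def prod_dividef power_divide)
    also have "(\<Prod>i\<in>UNIV. exp (- (G $ i \<bullet> (matrix_inv V *v G $ i)) / 2)) = exp (- (matrix_inv V \<bullet> gram G) / 2)"
      by (simp add: exp_sum[symmetric] gram_eq_sum_outer inner_sum_right inner_outer sum_negf sum_divide_distrib)
    finally have "(\<Prod>i\<in>UNIV. ?\<phi> (G $ i)) = ennreal ((1 / ?K) ^ ?n) * ennreal (exp (- (matrix_inv V \<bullet> gram G) / 2))"
      using K by (subst prod_ennreal) (simp_all add: mvn_density_def ennreal_mult)
    then show "f (gram G) * (\<Prod>i\<in>UNIV. ?\<phi> (G $ i)) = ennreal ((1 / ?K) ^ ?n) * (f (gram G) * ennreal (exp (- (matrix_inv V \<bullet> gram G) / 2)))"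
      by (simp only: mult_ac)
  qed
  also have "\<dots> = ennreal ((1 / ?K) ^ ?n) * (\<integral>\<^sup>+G. f (gram (G::real^'d^'d)) * ennreal (exp (- (matrix_inv V \<bullet> gram G) / 2)) \<partial>lborel)"
    by (rule nn_integral_cmult) measurable
  finally show "(\<integral>\<^sup>+M. f M \<partial>wishart V ?n) = ennreal ((1 / ?K) ^ ?n) * (\<integral>\<^sup>+G. f (gram (G::real^'d^'d)) * ennreal (exp (- (matrix_inv V \<bullet> gram G) / 2)) \<partial>lborel)" .
qed

text \<open>Induction on the number of surplus samples; each new sample raises the power of
  \<open>\<bar>det G\<bar>\<close> by one. Finiteness of \<open>\<kappa>\<close> is not claimed: the
  later inequalities carry the same \<open>\<kappa>\<close> on both sides.\<close>

lemma nn_integral_wishart: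
  fixes V :: "real^'d^'d"
  assumes V: "pos_def_mat V"
  shows "\<exists>\<kappa>. \<forall>f\<in>borel_measurable borel.
    (\<integral>\<^sup>+M. f M \<partial>wishart V (CARD('d) + j)) = \<kappa> * (\<integral>\<^sup>+G. f (gram (G::real^'d^'d)) * ennreal (wishart_weight (matrix_inv V) j (gram G)) \<partial>lborel)"
proof (induction j)
  case 0
  then show ?case using nn_integral_wishart_square[OF V] by (simp add: wishart_weight_gram)
next
  case (Suc j)
  let ?U = "matrix_inv V"
  let ?K = "sqrt ((2 * pi) ^ CARD('d) * det V)"
  obtain \<kappa> where \<kappa>: "\<And>f. f \<in> borel_measurable borel \<Longrightarrow>
    (\<integral>\<^sup>+M. f M \<partial>wishart V (CARD('d) + j)) = \<kappa> * (\<integral>\<^sup>+G. f (gram (G::real^'d^'d)) * ennreal (wishart_weight ?U j (gram G)) \<partial>lborel)"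
    using Suc by blast
  obtain \<kappa>' where \<kappa>': "\<And>g. g \<in> borel_measurable borel \<Longrightarrow>
    (\<integral>\<^sup>+x. (\<integral>\<^sup>+G. g (gram (G::real^'d^'d) + outer x) * ennreal (\<bar>det G\<bar> ^ j) \<partial>lborel) \<partial>lborel)
    = \<kappa>' * (\<integral>\<^sup>+G. g (gram (G::real^'d^'d)) * ennreal (\<bar>det G\<bar> ^ Suc j) \<partial>lborel)"
    using nn_integral_gram_add_outer by blast
  show ?case
  proof (intro exI ballI)
    fix f :: "real^'d^'d \<Rightarrow> ennreal"
    assume [measurable]: "f \<in> borel_measurable borel"
    \<comment> \<open>The exponents of the new sample and of the old weight add up to a function of
      \<open>gram G + outer x\<close>, which \<open>g\<close> absorbs into the test
      function.\<close>
    define g where "g M = f M * ennreal (exp (- (?U \<bullet> M) / 2))" for M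
    have [measurable]: "g \<in> borel_measurable borel" unfolding g_def[abs_def] by measurable
    have K: "0 \<le> ?K" using pos_def_mat_det_pos[OF V] by simp
    have pt: "ennreal (mvn_density V x) * (f (gram G + outer x) * ennreal (wishart_weight ?U j (gram G)))
        = ennreal (1 / ?K) * (g (gram G + outer x) * ennreal (\<bar>det G\<bar> ^ j))" for x and G :: "real^'d^'d"
    proof -
      have "mvn_density V x * wishart_weight ?U j (gram G)
          = 1 / ?K * (exp (- (?U \<bullet> (gram G + outer x)) / 2) * \<bar>det G\<bar> ^ j)"
      proof -
        have "exp (- (?U \<bullet> (gram G + outer x)) / 2) = exp (- (?U \<bullet> gram G) / 2) * exp (- (x \<bullet> (?U *v x)) / 2)"
          unfolding exp_add[symmetric] inner_add_right inner_outer by (simp add: field_simps)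
        then show ?thesis by (simp add: mvn_density_def wishart_weight_gram)
      qed
      then have eq: "ennreal (mvn_density V x) * ennreal (wishart_weight ?U j (gram G))
          = ennreal (1 / ?K) * (ennreal (exp (- (?U \<bullet> (gram G + outer x)) / 2)) * ennreal (\<bar>det G\<bar> ^ j))"
        using K by (simp add: ennreal_mult[symmetric] mvn_density_def wishart_weight_gram)
      show ?thesis
        unfolding mult.left_commute[of "ennreal (mvn_density V x)"] eq by (simp only: g_def mult_ac)
    qed
    have "(\<integral>\<^sup>+M. f M \<partial>wishart V (CARD('d) + Suc j))
       = (\<integral>\<^sup>+x. ennreal (mvn_density V x) * (\<kappa> * (\<integral>\<^sup>+G. f (gram (G::real^'d^'d) + outer x) * ennreal (wishart_weight ?U j (gram G)) \<partial>lborel)) \<partial>lborel)"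
      by (simp add: nn_integral_wishart_Suc[OF V] \<kappa>)
    also have "\<dots> = (\<integral>\<^sup>+x. \<kappa> * ennreal (1 / ?K) * (\<integral>\<^sup>+G. g (gram (G::real^'d^'d) + outer x) * ennreal (\<bar>det G\<bar> ^ j) \<partial>lborel) \<partial>lborel)"
    proof (rule nn_integral_cong)
      fix x :: "real^'d"
      have "ennreal (mvn_density V x) * (\<integral>\<^sup>+G. f (gram (G::real^'d^'d) + outer x) * ennreal (wishart_weight ?U j (gram G)) \<partial>lborel)
         = (\<integral>\<^sup>+G. ennreal (mvn_density V x) * (f (gram (G::real^'d^'d) + outer x) * ennreal (wishart_weight ?U j (gram G))) \<partial>lborel)"
        by (rule nn_integral_cmult[symmetric]) measurable
      also have "\<dots> = ennreal (1 / ?K) * (\<integral>\<^sup>+G. g (gram (G::real^'d^'d) + outer x) * ennreal (\<bar>det G\<bar> ^ j) \<partial>lborel)"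
        unfolding pt by (rule nn_integral_cmult) measurable
      finally show "ennreal (mvn_density V x) * (\<kappa> * (\<integral>\<^sup>+G. f (gram (G::real^'d^'d) + outer x) * ennreal (wishart_weight ?U j (gram G)) \<partial>lborel))
         = \<kappa> * ennreal (1 / ?K) * (\<integral>\<^sup>+G. g (gram (G::real^'d^'d) + outer x) * ennreal (\<bar>det G\<bar> ^ j) \<partial>lborel)"
        by (simp only: mult.left_commute mult.assoc)
    qed
    also have "\<dots> = \<kappa> * ennreal (1 / ?K) * (\<integral>\<^sup>+x. (\<integral>\<^sup>+G. g (gram (G::real^'d^'d) + outer x) * ennreal (\<bar>det G\<bar> ^ j) \<partial>lborel) \<partial>lborel)"
      by (rule nn_integral_cmult) measurable
    also have "\<dots> = \<kappa> * ennreal (1 / ?K) * \<kappa>' * (\<integral>\<^sup>+G. g (gram (G::real^'d^'d)) * ennreal (\<bar>det G\<bar> ^ Suc j) \<partial>lborel)"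
      by (simp only: \<kappa>'[OF \<open>g \<in> borel_measurable borel\<close>] mult.assoc)
    also have "(\<lambda>G::real^'d^'d. g (gram G) * ennreal (\<bar>det G\<bar> ^ Suc j)) = (\<lambda>G. f (gram G) * ennreal (wishart_weight ?U (Suc j) (gram G)))"
      by (simp only: g_def wishart_weight_gram fun_eq_iff ennreal_mult[OF zero_le_power[OF abs_ge_zero] exp_ge_zero]) (simp add: mult_ac)
    finally show "(\<integral>\<^sup>+M. f M \<partial>wishart V (CARD('d) + Suc j)) = \<kappa> * ennreal (1 / ?K) * \<kappa>' *
      (\<integral>\<^sup>+G. f (gram (G::real^'d^'d)) * ennreal (wishart_weight ?U (Suc j) (gram G)) \<partial>lborel)" .
  qed
qed

section \<open>Shifted chi-square variables\<close>

text \<open>An unnormalised density: if \<open>y\<close> is distributed according to it, then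
  \<open>p * y\<close> is chi-square with \<open>2 * m + 2\<close> degrees of freedom. Tail bounds
  are therefore stated relative to the total mass.\<close>

definition gamma_weight :: "real \<Rightarrow> real \<Rightarrow> real \<Rightarrow> real" where
  "gamma_weight m p y = (if 0 < y then y powr m * exp (- (p * y / 2)) else 0)"

lemma gamma_weight_measurable [measurable]: "gamma_weight m p \<in> borel_measurable borel"
  unfolding gamma_weight_def[abs_def] by measurable

lemma gamma_weight_nonneg: "0 \<le> gamma_weight m p y"
  by (simp add: gamma_weight_def)

lemma gamma_weight_eq_exp: "0 < y \<Longrightarrow> gamma_weight m p y = exp (m * ln y - p * y / 2)"
  by (simp add: gamma_weight_def powr_def flip: exp_add)

text \<open>Exponential tilting: the factor \<open>exp (- ((l - 1) * (p * y - s) / 2))\<close> is at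
  least \<open>1\<close> on the event, and the tilted weight is a rescaling of the original one. The
  case \<open>l < 1\<close> gives upper tails and \<open>l > 1\<close> lower tails.\<close>

lemma gamma_weight_chernoff:
  assumes p: "0 < p" and l: "0 < l"
  shows "(\<integral>\<^sup>+y. ennreal (gamma_weight m p y) * indicator {y. (l - 1) * (p * y - s) \<le> 0} y \<partial>lborel)
    \<le> ennreal (exp ((l - 1) * s / 2) * l powr (- (m + 1))) * (\<integral>\<^sup>+y. ennreal (gamma_weight m p y) \<partial>lborel)"
proof -
  have "(\<integral>\<^sup>+y. ennreal (gamma_weight m p y) * indicator {y. (l - 1) * (p * y - s) \<le> 0} y \<partial>lborel)
     \<le> (\<integral>\<^sup>+y. ennreal (exp ((l - 1) * s / 2) * l powr (- m)) * ennreal (gamma_weight m p (0 + l * y)) \<partial>lborel)"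
  proof (rule nn_integral_mono)
    fix y
    have "gamma_weight m p y * exp (- ((l - 1) * (p * y - s) / 2))
        = exp ((l - 1) * s / 2) * l powr (- m) * gamma_weight m p (l * y)"
    proof (cases "0 < y")
      case True
      have "exp (- (p * y / 2)) * exp (- ((l - 1) * (p * y - s) / 2))
          = exp ((l - 1) * s / 2) * exp (- (p * (l * y) / 2))"
        unfolding exp_add[symmetric] by (rule arg_cong[of _ _ exp]) (simp add: field_simps)
      moreover have "l powr (- m) * (l * y) powr m = y powr m"
        using l True by (simp add: powr_mult powr_minus field_simps)
      moreover have "0 < l * y" using True l by simp
      ultimately show ?thesis
        using True unfolding gamma_weight_def by (simp add: mult_ac)
    next
      case False
      then have "\<not> 0 < l * y" using l by (simp add: zero_less_mult_iff)
      then show ?thesis using False by (simp add: gamma_weight_def)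
    qed
    moreover have "gamma_weight m p y * indicator {y. (l - 1) * (p * y - s) \<le> 0} y
       \<le> gamma_weight m p y * exp (- ((l - 1) * (p * y - s) / 2))"
      by (rule mult_left_mono) (auto simp: indicator_def gamma_weight_nonneg)
    ultimately show "ennreal (gamma_weight m p y) * indicator {y. (l - 1) * (p * y - s) \<le> 0} y
       \<le> ennreal (exp ((l - 1) * s / 2) * l powr (- m)) * ennreal (gamma_weight m p (0 + l * y))"
      by (auto simp: indicator_def ennreal_mult[symmetric] gamma_weight_nonneg intro!: ennreal_leI)
  qed
  also have "\<dots> = ennreal (exp ((l - 1) * s / 2) * l powr (- m)) * (\<integral>\<^sup>+y. ennreal (gamma_weight m p (0 + l * y)) \<partial>lborel)"
    by (rule nn_integral_cmult) measurable
  also have "ennreal (exp ((l - 1) * s / 2) * l powr (- m)) = ennreal (exp ((l - 1) * s / 2) * l powr (- (m + 1))) * ennreal l"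
  proof -
    have "l powr (- (m + 1)) * l = l powr (- m)"
      using powr_add[of l "- (m + 1)" 1] l by simp
    then show ?thesis
      using l by (subst ennreal_mult[symmetric]) (simp_all add: mult.assoc)
  qed
  also have "\<dots> * (\<integral>\<^sup>+y. ennreal (gamma_weight m p (0 + l * y)) \<partial>lborel)
      = ennreal (exp ((l - 1) * s / 2) * l powr (- (m + 1))) * (\<integral>\<^sup>+y. ennreal (gamma_weight m p y) \<partial>lborel)"
    using nn_integral_real_affine[of "\<lambda>y. ennreal (gamma_weight m p y)" l 0] l by (simp add: mult.assoc)
  finally show ?thesis .
qed

section \<open>Likelihood ratio of a unit shift\<close>

text \<open>The logarithm of the ratio of the weights at \<open>y\<close> and \<open>y + 1\<close>
  is \<open>p / 2 - m * (ln (y + 1) - ln y)\<close>. For \<open>p * y < s\<close> the difference of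
  logarithms is at least \<open>1 / (y + 1)\<close>, hence at least \<open>p / (s + p)\<close>; the
  remaining \<open>y\<close> are charged to the tail.\<close>

lemma nn_integral_gamma_shift_le:
  fixes h :: "real \<Rightarrow> ennreal"
  assumes [measurable]: "h \<in> borel_measurable borel" and h1: "\<And>y. h y \<le> 1"
    and p: "0 < p" and m: "0 \<le> m" and s: "0 \<le> s" and e: "p / 2 - m * p / (s + p) \<le> e"
  shows "(\<integral>\<^sup>+y. h (y + 1) * ennreal (gamma_weight m p y) \<partial>lborel) \<le>
    ennreal (exp e) * (\<integral>\<^sup>+y. h y * ennreal (gamma_weight m p y) \<partial>lborel) +
    (\<integral>\<^sup>+y. ennreal (gamma_weight m p y) * indicator {y. s \<le> p * y} y \<partial>lborel)"
proof -
  have "(\<integral>\<^sup>+y. h (y + 1) * ennreal (gamma_weight m p y) \<partial>lborel) \<le>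
    (\<integral>\<^sup>+y. ennreal (exp e) * (h (y + 1) * ennreal (gamma_weight m p (y + 1))) +
       ennreal (gamma_weight m p y) * indicator {y. s \<le> p * y} y \<partial>lborel)"
  proof (rule nn_integral_mono)
    fix y
    consider "y \<le> 0" | "s \<le> p * y" "0 < y" | "p * y < s" "0 < y" by linarith
    then show "h (y + 1) * ennreal (gamma_weight m p y) \<le> ennreal (exp e) * (h (y + 1) * ennreal (gamma_weight m p (y + 1))) +
       ennreal (gamma_weight m p y) * indicator {y. s \<le> p * y} y"
    proof cases
      case 2
      have "h (y + 1) * gamma_weight m p y \<le> 1 * ennreal (gamma_weight m p y)"
        by (rule mult_right_mono) (auto simp: h1)
      with 2 show ?thesis by (simp add: add_increasing)
    next
      case 3
      have "p / (s + p) \<le> 1 / (y + 1)"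
        using 3 p s by (simp add: field_simps)
      also have "\<dots> \<le> ln (y + 1) - ln y"
      proof -
        have "ln y - ln (y + 1) \<le> y / (y + 1) - 1"
          using 3 ln_le_minus_one[of "y / (y + 1)"] by (simp add: ln_div)
        also have "\<dots> = - (1 / (y + 1))" using 3 by (simp add: field_simps)
        finally show ?thesis by simp
      qed
      finally have "m * (p / (s + p)) \<le> m * (ln (y + 1) - ln y)"
        using m by (rule mult_left_mono)
      moreover have "m * (ln (y + 1) - ln y) = m * ln (y + 1) - m * ln y"
        by (rule right_diff_distrib)
      moreover have "m * (p / (s + p)) = m * p / (s + p)" by simp
      moreover have "p * (y + 1) / 2 = p * y / 2 + p / 2" by (simp add: field_simps)
      ultimately have "m * ln y - p * y / 2 \<le> e + (m * ln (y + 1) - p * (y + 1) / 2)"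
        using e by linarith
      then have "exp (m * ln y - p * y / 2) \<le> exp (e + (m * ln (y + 1) - p * (y + 1) / 2))"
        by simp
      then have "gamma_weight m p y \<le> exp e * gamma_weight m p (y + 1)"
        using 3 by (simp add: gamma_weight_eq_exp exp_add)
      then have "h (y + 1) * ennreal (gamma_weight m p y) \<le> h (y + 1) * ennreal (exp e * gamma_weight m p (y + 1))"
        by (intro mult_left_mono ennreal_leI) auto
      then show ?thesis
        by (simp add: ennreal_mult gamma_weight_nonneg mult.left_commute add_increasing2)
    qed (simp add: gamma_weight_def)
  qed
  also have "\<dots> = ennreal (exp e) * (\<integral>\<^sup>+y. h (y + 1) * ennreal (gamma_weight m p (y + 1)) \<partial>lborel) +
    (\<integral>\<^sup>+y. ennreal (gamma_weight m p y) * indicator {y. s \<le> p * y} y \<partial>lborel)"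
    by (simp add: nn_integral_add nn_integral_cmult)
  also have "(\<integral>\<^sup>+y. h (y + 1) * ennreal (gamma_weight m p (y + 1)) \<partial>lborel) = (\<integral>\<^sup>+y. h y * ennreal (gamma_weight m p y) \<partial>lborel)"
    using nn_integral_real_affine[of "\<lambda>y. h y * gamma_weight m p y" 1 1] by (simp add: add.commute)
  finally show ?thesis .
qed

text \<open>The reverse direction: here small \<open>y\<close> are critical. For
  \<open>p * y > s\<close> the assumption \<open>p < s\<close> forces \<open>y > 1\<close>, and
  \<open>ln y - ln (y - 1)\<close> is at most \<open>1 / (y - 1)\<close>, hence at most
  \<open>p / (s - p)\<close>.\<close>

lemma nn_integral_gamma_unshift_le:
  fixes h :: "real \<Rightarrow> ennreal"
  assumes [measurable]: "h \<in> borel_measurable borel" and h1: "\<And>y. h y \<le> 1"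
    and p: "0 < p" and m: "0 \<le> m" and s: "p < s" and e: "m * p / (s - p) - p / 2 \<le> e"
  shows "(\<integral>\<^sup>+y. h y * ennreal (gamma_weight m p y) \<partial>lborel) \<le>
    ennreal (exp e) * (\<integral>\<^sup>+y. h (y + 1) * ennreal (gamma_weight m p y) \<partial>lborel) +
    (\<integral>\<^sup>+y. ennreal (gamma_weight m p y) * indicator {y. p * y \<le> s} y \<partial>lborel)"
proof -
  have "(\<integral>\<^sup>+y. h y * ennreal (gamma_weight m p y) \<partial>lborel) \<le>
    (\<integral>\<^sup>+y. ennreal (exp e) * (h y * ennreal (gamma_weight m p (y - 1))) +
       ennreal (gamma_weight m p y) * indicator {y. p * y \<le> s} y \<partial>lborel)"
  proof (rule nn_integral_mono)
    fix y
    show "h y * ennreal (gamma_weight m p y) \<le> ennreal (exp e) * (h y * ennreal (gamma_weight m p (y - 1))) +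
       ennreal (gamma_weight m p y) * indicator {y. p * y \<le> s} y"
    proof (cases "p * y \<le> s")
      case True
      have "h y * gamma_weight m p y \<le> 1 * ennreal (gamma_weight m p y)"
        by (rule mult_right_mono) (auto simp: h1)
      with True show ?thesis by (simp add: add_increasing)
    next
      case False
      then have "p * 1 < p * y" using s by simp
      then have y: "1 < y" using p by simp
      have "ln y - ln (y - 1) \<le> 1 / (y - 1)"
      proof -
        have "ln y - ln (y - 1) \<le> y / (y - 1) - 1"
          using y ln_le_minus_one[of "y / (y - 1)"] by (simp add: ln_div)
        also have "\<dots> = 1 / (y - 1)" using y by (simp add: field_simps)
        finally show ?thesis by simp
      qed
      also have "\<dots> \<le> p / (s - p)"
        using False p s y by (simp add: field_simps)
      finally have "m * (ln y - ln (y - 1)) \<le> m * (p / (s - p))"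
        using m by (rule mult_left_mono)
      moreover have "m * (ln y - ln (y - 1)) = m * ln y - m * ln (y - 1)"
        by (rule right_diff_distrib)
      moreover have "m * (p / (s - p)) = m * p / (s - p)" by simp
      moreover have "p * (y - 1) / 2 = p * y / 2 - p / 2" by (simp add: field_simps)
      ultimately have "m * ln y - p * y / 2 \<le> e + (m * ln (y - 1) - p * (y - 1) / 2)"
        using e by linarith
      then have "exp (m * ln y - p * y / 2) \<le> exp (e + (m * ln (y - 1) - p * (y - 1) / 2))"
        by simp
      then have "gamma_weight m p y \<le> exp e * gamma_weight m p (y - 1)"
        using y by (simp add: gamma_weight_eq_exp exp_add)
      then have "h y * ennreal (gamma_weight m p y) \<le> h y * ennreal (exp e * gamma_weight m p (y - 1))"
        by (intro mult_left_mono ennreal_leI) auto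
      then show ?thesis
        by (simp add: ennreal_mult gamma_weight_nonneg mult.left_commute add_increasing2)
    qed
  qed
  also have "\<dots> = ennreal (exp e) * (\<integral>\<^sup>+y. h y * ennreal (gamma_weight m p (y - 1)) \<partial>lborel) +
    (\<integral>\<^sup>+y. ennreal (gamma_weight m p y) * indicator {y. p * y \<le> s} y \<partial>lborel)"
    by (simp add: nn_integral_add nn_integral_cmult)
  also have "(\<integral>\<^sup>+y. h y * ennreal (gamma_weight m p (y - 1)) \<partial>lborel) = (\<integral>\<^sup>+y. h (y + 1) * ennreal (gamma_weight m p y) \<partial>lborel)"
    using nn_integral_real_affine[of "\<lambda>y. h y * gamma_weight m p (y - 1)" 1 1] by (simp add: add.commute)
  finally show ?thesis .
qed

section \<open>Tail bounds and the one-dimensional privacy estimate\<close>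

text \<open>The difference of the two sides vanishes at \<open>0\<close> and has derivative
  \<open>x^2 / (1 - x)\<close>. The quadratic term improves the Chernoff exponent of the lower
  tail.\<close>

lemma ln_one_minus_le:
  assumes "0 \<le> v" "v < (1::real)"
  shows "ln (1 - v) \<le> - v - v\<^sup>2 / 2"
proof -
  define f where "f v = - v - v\<^sup>2 / 2 - ln (1 - v)" for v :: real
  have "f 0 \<le> f v"
  proof (rule DERIV_nonneg_imp_nondecreasing[OF assms(1)])
    fix x assume x: "0 \<le> x" "x \<le> v"
    then have "x < 1" using assms by simp
    then have "(f has_real_derivative x\<^sup>2 / (1 - x)) (at x)"
      unfolding f_def[abs_def] by (auto intro!: derivative_eq_intros simp: power2_eq_square field_simps)
    then show "\<exists>y. (f has_real_derivative y) (at x) \<and> 0 \<le> y"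
      using \<open>x < 1\<close> by auto
  qed
  then show ?thesis by (simp add: f_def)
qed

text \<open>The threshold is \<open>k * w^2\<close>, where \<open>k\<close> is the mean of the
  chi-square variable. The tilt \<open>l = 1 / w^2\<close> minimises the Chernoff bound there;
  \<open>w > 1\<close> covers upper tails and \<open>w < 1\<close> lower tails.\<close>

lemma gamma_tail_le:
  assumes p: "0 < p" and k: "0 < k" and w: "0 < w"
    and sub: "\<And>y. P y \<Longrightarrow> (1 / w\<^sup>2 - 1) * (p * y - k * w\<^sup>2) \<le> 0"
    and le: "k / 2 * (1 - w\<^sup>2 + 2 * ln w) \<le> - r"
  shows "(\<integral>\<^sup>+y. ennreal (gamma_weight (k / 2 - 1) p y) * indicator {y. P y} y \<partial>lborel)
    \<le> ennreal (exp (- r)) * (\<integral>\<^sup>+y. ennreal (gamma_weight (k / 2 - 1) p y) \<partial>lborel)"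
proof -
  let ?l = "1 / w\<^sup>2"
  have "(\<integral>\<^sup>+y. ennreal (gamma_weight (k / 2 - 1) p y) * indicator {y. P y} y \<partial>lborel)
     \<le> (\<integral>\<^sup>+y. ennreal (gamma_weight (k / 2 - 1) p y) * indicator {y. (?l - 1) * (p * y - k * w\<^sup>2) \<le> 0} y \<partial>lborel)"
    using sub by (intro nn_integral_mono mult_left_mono) (auto simp: indicator_def)
  also have "\<dots> \<le> ennreal (exp ((?l - 1) * (k * w\<^sup>2) / 2) * ?l powr (- (k / 2 - 1 + 1))) *
      (\<integral>\<^sup>+y. ennreal (gamma_weight (k / 2 - 1) p y) \<partial>lborel)"
    using p w by (intro gamma_weight_chernoff) auto
  also have "\<dots> \<le> ennreal (exp (- r)) * (\<integral>\<^sup>+y. ennreal (gamma_weight (k / 2 - 1) p y) \<partial>lborel)"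
  proof (rule mult_right_mono[OF ennreal_leI])
    have 1: "(?l - 1) * (k * w\<^sup>2) / 2 = k / 2 * (1 - w\<^sup>2)"
      using w by (simp add: field_simps)
    have "ln ?l = - (2 * ln w)"
      using w by (simp add: ln_div ln_realpow)
    then have "?l powr (- (k / 2 - 1 + 1)) = exp (k / 2 * (2 * ln w))"
      using w by (simp add: powr_def)
    then have "exp ((?l - 1) * (k * w\<^sup>2) / 2) * ?l powr (- (k / 2 - 1 + 1)) = exp (k / 2 * (1 - w\<^sup>2 + 2 * ln w))"
      unfolding 1 by (simp only: exp_add[symmetric] distrib_left)
    then show "exp ((?l - 1) * (k * w\<^sup>2) / 2) * ?l powr (- (k / 2 - 1 + 1)) \<le> exp (- r)"
      using le by simp
  qed simp
  finally show ?thesis .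
qed

text \<open>The cut-offs lie a relative distance of order \<open>u\<close> from the mean
  \<open>k\<close>, so that \<open>2 * t \<le> k * u^2\<close> bounds either tail by
  \<open>exp (- t)\<close>. The two factors of \<epsilon> add up to one, as both estimates are used
  in succession.\<close>

lemma gamma_shift_dp:
  fixes h :: "real \<Rightarrow> ennreal"
  assumes h: "h \<in> borel_measurable borel" "\<And>y. h y \<le> 1"
    and p: "0 < p" and u: "0 < u" "u < 1" and \<epsilon>: "2 * u * p / (1 - u)\<^sup>2 \<le> \<epsilon>" "\<epsilon> < 1"
    and k: "2 * t \<le> k * u\<^sup>2" and t: "9 / 4 \<le> t"
  shows "(\<integral>\<^sup>+y. h (y + 1) * ennreal (gamma_weight (k / 2 - 1) p y) \<partial>lborel) \<le>
      ennreal (exp (11 / 20 * \<epsilon>)) * (\<integral>\<^sup>+y. h y * ennreal (gamma_weight (k / 2 - 1) p y) \<partial>lborel) +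
      ennreal (exp (- t)) * (\<integral>\<^sup>+y. ennreal (gamma_weight (k / 2 - 1) p y) \<partial>lborel)" (is ?A)
    and "(\<integral>\<^sup>+y. h y * ennreal (gamma_weight (k / 2 - 1) p y) \<partial>lborel) \<le>
      ennreal (exp (9 / 20 * \<epsilon>)) * (\<integral>\<^sup>+y. h (y + 1) * ennreal (gamma_weight (k / 2 - 1) p y) \<partial>lborel) +
      ennreal (exp (- t)) * (\<integral>\<^sup>+y. ennreal (gamma_weight (k / 2 - 1) p y) \<partial>lborel)" (is ?B)
proof -
  \<comment> \<open>This lower bound controls the lower-order terms: the \<open>2\<close> in
    \<open>k - 2\<close> and, below, the size of \<open>p\<close> relative to
    \<open>k * u\<close>.\<close>
  have ku2: "9 / 2 \<le> k * u\<^sup>2" using k t by linarith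
  then have "0 < k * u\<^sup>2" by linarith
  then have k0: "0 < k" using u by (simp add: zero_less_mult_iff)
  have "k * u\<^sup>2 \<le> k * 1" using u k0 by (intro mult_left_mono) (auto simp: power_le_one)
  then have k4: "9 / 2 \<le> k" using ku2 by linarith
  have m0: "0 \<le> k / 2 - 1" using k4 by linarith
  have pu: "2 * u * p \<le> \<epsilon> * (1 - u)\<^sup>2"
    using \<epsilon>(1) u by (simp add: field_simps)
  have \<epsilon>0: "0 < \<epsilon>"
    using \<epsilon>(1) p u by (smt (verit) divide_pos_pos mult_pos_pos zero_less_power)
  have "\<epsilon> * (1 - u)\<^sup>2 \<le> 1 * (1 - u)\<^sup>2" using \<epsilon> by (intro mult_right_mono) auto
  then have pu1: "2 * u * p \<le> (1 - u)\<^sup>2" using pu by linarith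
  have sq1: "(1 - u)\<^sup>2 \<le> 1" using u by (simp add: power_le_one)
  have p_le: "9 * p \<le> (k * u) * (1 - u)\<^sup>2"
  proof -
    have "u * (9 * p) = 9 / 2 * (2 * u * p)" by simp
    also have "\<dots> \<le> 9 / 2 * (1 - u)\<^sup>2" using pu1 by (intro mult_left_mono) auto
    also have "\<dots> \<le> (k * u\<^sup>2) * (1 - u)\<^sup>2" using ku2 by (intro mult_right_mono) auto
    also have "\<dots> = u * ((k * u) * (1 - u)\<^sup>2)" by (simp add: power2_eq_square)
    finally show ?thesis using u by simp
  qed
  have ku0: "0 < k * u" using k0 u by simp
  show ?A
  proof -
    define s where "s = k * (1 + u)\<^sup>2"
    have s0: "0 < s" using k0 u by (simp add: s_def)
    have "(\<integral>\<^sup>+y. h (y + 1) * ennreal (gamma_weight (k / 2 - 1) p y) \<partial>lborel) \<le>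
       ennreal (exp (11 / 20 * \<epsilon>)) * (\<integral>\<^sup>+y. h y * ennreal (gamma_weight (k / 2 - 1) p y) \<partial>lborel) +
       (\<integral>\<^sup>+y. ennreal (gamma_weight (k / 2 - 1) p y) * indicator {y. s \<le> p * y} y \<partial>lborel)"
    proof (rule nn_integral_gamma_shift_le[OF h p m0])
      \<comment> \<open>The leading term on the left is \<open>2 * (k * u)\<close>. The excess of
        \<open>11 / 5\<close> over \<open>2\<close> pays for \<open>p\<close>, which is at most
        \<open>k * u / 9\<close>, and the terms in \<open>k * u * u\<close> pay for the constant
        \<open>2\<close>.\<close>
      have "s + p - (k - 2) \<le> 11 / 5 * u * (s + p)"
      proof -
        have "9 * p \<le> (k * u) * 1"
          using p_le ku0 sq1 mult_left_mono[OF sq1, of "k * u"] by linarith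
        moreover have "2 \<le> 4 / 9 * (k * u * u)" using ku2 by (simp add: power2_eq_square mult.assoc)
        moreover have "s = k + 2 * (k * u) + k * u * u"
          by (simp add: s_def power2_eq_square algebra_simps)
        moreover have "11 / 5 * u * (s + p) = 11 / 5 * (k * u) + 22 / 5 * (k * u * u) + 11 / 5 * (k * u * u * u) + 11 / 5 * (u * p)"
          by (simp add: s_def power2_eq_square algebra_simps)
        moreover have "0 < k * u * u * u" "0 < u * p" "0 < k * u * u" using k0 u p by simp_all
        ultimately show ?thesis using ku0 by linarith
      qed
      then have "1 - (k - 2) / (s + p) \<le> 11 / 5 * u"
        using s0 p by (simp add: field_simps)
      then have "p / 2 * (1 - (k - 2) / (s + p)) \<le> p / 2 * (11 / 5 * u)"
        using p by (intro mult_left_mono) auto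
      moreover have "p / 2 * (1 - (k - 2) / (s + p)) = p / 2 - (k / 2 - 1) * p / (s + p)"
        by (simp add: right_diff_distrib diff_divide_distrib mult.commute)
      moreover have "p / 2 * (11 / 5 * u) = 11 / 20 * (2 * u * p)" by simp
      moreover have "\<epsilon> * (1 - u)\<^sup>2 \<le> \<epsilon> * 1" using \<epsilon>0 sq1 by (intro mult_left_mono) auto
      ultimately show "p / 2 - (k / 2 - 1) * p / (s + p) \<le> 11 / 20 * \<epsilon>"
        using pu by linarith
    qed (use s0 in simp)
    also have "(\<integral>\<^sup>+y. ennreal (gamma_weight (k / 2 - 1) p y) * indicator {y. s \<le> p * y} y \<partial>lborel)
        \<le> ennreal (exp (- t)) * (\<integral>\<^sup>+y. ennreal (gamma_weight (k / 2 - 1) p y) \<partial>lborel)"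
    proof (rule gamma_tail_le[OF p k0, of "1 + u"])
      fix y assume "s \<le> p * y"
      moreover have "1 / (1 + u)\<^sup>2 \<le> 1" using u by (simp add: one_le_power)
      ultimately show "(1 / (1 + u)\<^sup>2 - 1) * (p * y - k * (1 + u)\<^sup>2) \<le> 0"
        by (intro mult_nonpos_nonneg) (auto simp: s_def)
    next
      have "ln (1 + u) \<le> u" using u ln_add_one_self_le_self by simp
      then have "1 - (1 + u)\<^sup>2 + 2 * ln (1 + u) \<le> - u\<^sup>2"
        by (simp add: power2_eq_square algebra_simps)
      then have "k / 2 * (1 - (1 + u)\<^sup>2 + 2 * ln (1 + u)) \<le> k / 2 * (- u\<^sup>2)"
        using k0 by (intro mult_left_mono) auto
      then show "k / 2 * (1 - (1 + u)\<^sup>2 + 2 * ln (1 + u)) \<le> - t"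
        using k by (simp add: algebra_simps)
    qed (use u in auto)
    finally show ?A by (simp add: add_left_mono)
  qed
  show ?B
  proof -
    txt \<open>The Chernoff exponent of the lower tail is twice that of the upper tail, so a deviation of \<open>3/4 u\<close> suffices;
      this slack pays for the terms that are linear in \<^term>\<open>p\<close>.\<close>
    define v where "v = 3 / 4 * u"
    define s where "s = k * (1 - v)\<^sup>2"
    have v: "0 < v" "v < 1" using u by (auto simp: v_def)
    have s0: "0 < s" using k0 v by (simp add: s_def)
    have s_ge: "k * (1 - u)\<^sup>2 \<le> s"
      unfolding s_def using u k0 by (intro mult_left_mono power_mono) (auto simp: v_def)
    \<comment> \<open>A lower bound for \<open>s - p\<close> that retains the factor
      \<open>(1 - u)^2\<close>, to be matched with the denominator of the condition on
      \<epsilon>.\<close>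
    define D where "D = k * (1 - u)\<^sup>2 * (1 - u / 9)"
    have D0: "0 < D" using k0 u by (simp add: D_def)
    have Ds: "D \<le> s - p"
      using s_ge p_le by (simp add: D_def algebra_simps)
    have ps: "p < s" using D0 Ds by linarith
    have "(\<integral>\<^sup>+y. h y * ennreal (gamma_weight (k / 2 - 1) p y) \<partial>lborel) \<le>
       ennreal (exp (9 / 20 * \<epsilon>)) * (\<integral>\<^sup>+y. h (y + 1) * ennreal (gamma_weight (k / 2 - 1) p y) \<partial>lborel) +
       (\<integral>\<^sup>+y. ennreal (gamma_weight (k / 2 - 1) p y) * indicator {y. p * y \<le> s} y \<partial>lborel)"
    proof (rule nn_integral_gamma_unshift_le[OF h p m0 ps])
      have "(1 - u)\<^sup>2 * ((k - 2) - (s - p)) \<le> 9 / 5 * u * (s - p)"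
      proof -
        \<comment> \<open>The deviation \<open>3 / 4 * u\<close> makes the leading coefficient
          \<open>3 / 2\<close>; together with \<open>1 / 9\<close> from \<open>p\<close> it stays
          below \<open>9 / 5\<close>.\<close>
        have *: "(k - 2) - (s - p) \<le> k * u * (9 / 5 * (1 - u / 9))"
        proof -
          have "9 * p \<le> (k * u) * 1"
            using p_le ku0 sq1 mult_left_mono[OF sq1, of "k * u"] by linarith
          moreover have "s = k - 3 / 2 * (k * u) + 9 / 16 * (k * u * u)"
            by (simp add: s_def v_def power2_eq_square algebra_simps)
          moreover have "k * u * (9 / 5 * (1 - u / 9)) = 9 / 5 * (k * u) - 1 / 5 * (k * u * u)"
            by (simp add: field_simps)
          moreover have "0 < k * u * u" using k0 u by simp
          ultimately show ?thesis using ku0 by linarith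
        qed
        have "(1 - u)\<^sup>2 * ((k - 2) - (s - p)) \<le> (1 - u)\<^sup>2 * (k * u * (9 / 5 * (1 - u / 9)))"
          using * by (intro mult_left_mono) auto
        also have "\<dots> = 9 / 5 * u * D" by (simp add: D_def)
        also have "\<dots> \<le> 9 / 5 * u * (s - p)" using Ds u by (intro mult_left_mono) auto
        finally show ?thesis .
      qed
      then have "(k - 2) / (s - p) - 1 \<le> 9 / 5 * u / (1 - u)\<^sup>2"
        using ps u by (simp add: field_simps)
      then have "p / 2 * ((k - 2) / (s - p) - 1) \<le> p / 2 * (9 / 5 * u / (1 - u)\<^sup>2)"
        using p by (intro mult_left_mono) auto
      moreover have "p / 2 * ((k - 2) / (s - p) - 1) = (k / 2 - 1) * p / (s - p) - p / 2"
        by (simp add: right_diff_distrib diff_divide_distrib mult.commute)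
      moreover have "p / 2 * (9 / 5 * u / (1 - u)\<^sup>2) = 9 / 20 * (2 * u * p / (1 - u)\<^sup>2)" by simp
      ultimately show "(k / 2 - 1) * p / (s - p) - p / 2 \<le> 9 / 20 * \<epsilon>"
        using \<epsilon>(1) by linarith
    qed
    also have "(\<integral>\<^sup>+y. ennreal (gamma_weight (k / 2 - 1) p y) * indicator {y. p * y \<le> s} y \<partial>lborel)
        \<le> ennreal (exp (- t)) * (\<integral>\<^sup>+y. ennreal (gamma_weight (k / 2 - 1) p y) \<partial>lborel)"
    proof (rule gamma_tail_le[OF p k0, of "1 - v"])
      fix y assume "p * y \<le> s"
      moreover have "1 \<le> 1 / (1 - v)\<^sup>2" using v by (simp add: power_le_one)
      ultimately show "(1 / (1 - v)\<^sup>2 - 1) * (p * y - k * (1 - v)\<^sup>2) \<le> 0"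
        by (intro mult_nonneg_nonpos) (auto simp: s_def)
    next
      have "ln (1 - v) \<le> - v - v\<^sup>2 / 2" using v by (intro ln_one_minus_le) auto
      then have "1 - (1 - v)\<^sup>2 + 2 * ln (1 - v) \<le> - 2 * v\<^sup>2"
        by (simp add: power2_eq_square algebra_simps)
      then have "k / 2 * (1 - (1 - v)\<^sup>2 + 2 * ln (1 - v)) \<le> k / 2 * (- 2 * v\<^sup>2)"
        using k0 by (intro mult_left_mono) auto
      also have "\<dots> = - (9 / 16) * (k * u\<^sup>2)" by (simp add: v_def power2_eq_square)
      also have "\<dots> \<le> - t" using k t by simp
      finally show "k / 2 * (1 - (1 - v)\<^sup>2 + 2 * ln (1 - v)) \<le> - t" .
    qed (use v in auto)
    finally show ?B by (simp add: add_left_mono)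
  qed
qed

section \<open>Privacy of the Wishart mechanism\<close>

text \<open>On the line the square root of the determinant is proportional to
  \<open>\<bar>z\<bar>\<close>. With \<open>y = z^2\<close> the weight contributes the power
  \<open>j / 2\<close> of \<open>y\<close> and the substitution the power \<open>- 1 / 2\<close>: a
  chi-square weight with \<open>Suc j\<close> degrees of freedom.\<close>

lemma nn_integral_wishart_weight_fibre:
  fixes h :: "real \<Rightarrow> ennreal"
  assumes [measurable]: "h \<in> borel_measurable borel" and c: "0 \<le> c"
    and det: "\<And>z. det (M + z\<^sup>2 *\<^sub>R outer a) = c * z\<^sup>2"
  shows "(\<integral>\<^sup>+z. h (z\<^sup>2) * ennreal (wishart_weight U j (M + z\<^sup>2 *\<^sub>R outer a)) \<partial>lborel) =
    ennreal (sqrt c ^ j * exp (- (U \<bullet> M) / 2)) *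
    (\<integral>\<^sup>+y. h y * ennreal (gamma_weight (real (Suc j) / 2 - 1) (a \<bullet> (U *v a)) y) \<partial>lborel)"
proof -
  let ?p = "a \<bullet> (U *v a)" and ?A = "sqrt c ^ j * exp (- (U \<bullet> M) / 2)"
  have w: "wishart_weight U j (M + z\<^sup>2 *\<^sub>R outer a) = ?A * (sqrt (z\<^sup>2) ^ j * exp (- (?p * z\<^sup>2 / 2)))" for z
  proof -
    have "- (U \<bullet> (M + z\<^sup>2 *\<^sub>R outer a)) / 2 = - (U \<bullet> M) / 2 + - (?p * z\<^sup>2 / 2)"
      by (simp add: inner_add_right inner_outer field_simps)
    then have "exp (- (U \<bullet> (M + z\<^sup>2 *\<^sub>R outer a)) / 2) = exp (- (U \<bullet> M) / 2) * exp (- (?p * z\<^sup>2 / 2))"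
      by (simp only: exp_add)
    then show ?thesis
      unfolding wishart_weight_def det real_sqrt_mult power_mult_distrib by simp
  qed
  have "(\<integral>\<^sup>+z. h (z\<^sup>2) * ennreal (wishart_weight U j (M + z\<^sup>2 *\<^sub>R outer a)) \<partial>lborel)
      = (\<integral>\<^sup>+y. h y * ennreal (?A * (sqrt y ^ j * exp (- (?p * y / 2)))) * ennreal (if 0 < y then y powr (- 1 / 2) else 0) \<partial>lborel)"
    unfolding w by (rule nn_integral_power2) measurable
  also have "\<dots> = (\<integral>\<^sup>+y. ennreal ?A * (h y * ennreal (gamma_weight (real (Suc j) / 2 - 1) ?p y)) \<partial>lborel)"
  proof (rule nn_integral_cong)
    fix y :: real
    have "?A * (sqrt y ^ j * exp (- (?p * y / 2))) * (if 0 < y then y powr (- 1 / 2) else 0)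
        = ?A * gamma_weight (real (Suc j) / 2 - 1) ?p y"
    proof (cases "0 < y")
      case True
      have "sqrt y ^ j = y powr (real j / 2)"
        using True by (simp add: powr_half_sqrt[symmetric] powr_realpow[symmetric] powr_powr)
      then have "sqrt y ^ j * y powr (- 1 / 2) = y powr (real (Suc j) / 2 - 1)"
        using powr_add[of y "real j / 2" "- 1 / 2"] by (simp add: field_simps)
      then show ?thesis using True by (simp add: gamma_weight_def)
    qed (simp add: gamma_weight_def)
    then have "ennreal (?A * (sqrt y ^ j * exp (- (?p * y / 2)))) * ennreal (if 0 < y then y powr (- 1 / 2) else 0)
        = ennreal ?A * ennreal (gamma_weight (real (Suc j) / 2 - 1) ?p y)"
      using c by (subst (1 2) ennreal_mult''[symmetric]) (simp_all add: gamma_weight_nonneg)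
    then show "h y * ennreal (?A * (sqrt y ^ j * exp (- (?p * y / 2)))) * ennreal (if 0 < y then y powr (- 1 / 2) else 0)
        = ennreal ?A * (h y * ennreal (gamma_weight (real (Suc j) / 2 - 1) ?p y))"
      unfolding mult.assoc mult.left_commute[of "ennreal ?A"] by simp
  qed
  also have "\<dots> = ennreal ?A * (\<integral>\<^sup>+y. h y * ennreal (gamma_weight (real (Suc j) / 2 - 1) ?p y) \<partial>lborel)"
    by (rule nn_integral_cmult) measurable
  finally show ?thesis .
qed

text \<open>On each line \<open>M + y *\<^sub>R outer a\<close>, adding \<open>outer a\<close> is
  the shift of \<open>y\<close> by one, so the one-dimensional estimate applies line by line. Its
  error is relative to the mass of the line, and the total mass is one.\<close>

lemma wishart_shift_dp:
  fixes V :: "real^'d^'d" and S :: "(real^'d^'d) set"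
  assumes V: "pos_def_mat V" and S[measurable]: "S \<in> sets borel" and a: "a \<noteq> 0"
    and p: "0 < a \<bullet> (matrix_inv V *v a)"
    and u: "0 < u" "u < 1" and \<epsilon>: "2 * u * (a \<bullet> (matrix_inv V *v a)) / (1 - u)\<^sup>2 \<le> \<epsilon>" "\<epsilon> < 1"
    and k: "2 * t \<le> real (Suc j) * u\<^sup>2" and t: "9 / 4 \<le> t"
  shows "emeasure (wishart V (CARD('d) + j)) {M. M + outer a \<in> S} \<le>
      ennreal (exp (11 / 20 * \<epsilon>)) * emeasure (wishart V (CARD('d) + j)) S + ennreal (exp (- t))" (is ?A)
    and "emeasure (wishart V (CARD('d) + j)) S \<le>
      ennreal (exp (9 / 20 * \<epsilon>)) * emeasure (wishart V (CARD('d) + j)) {M. M + outer a \<in> S} + ennreal (exp (- t))" (is ?B)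
proof -
  let ?W = "wishart V (CARD('d) + j)" and ?w = "wishart_weight (matrix_inv V) j"
  let ?\<gamma> = "gamma_weight (real (Suc j) / 2 - 1) (a \<bullet> (matrix_inv V *v a))"
  interpret prob_space ?W using V by (rule prob_space_wishart)
  obtain \<kappa> where \<kappa>: "\<And>f. f \<in> borel_measurable borel \<Longrightarrow>
    (\<integral>\<^sup>+M. f M \<partial>?W) = \<kappa> * (\<integral>\<^sup>+G. f (gram (G::real^'d^'d)) * ennreal (?w (gram G)) \<partial>lborel)"
    using nn_integral_wishart[OF V] by blast
  have main: "(\<integral>\<^sup>+M. f1 M \<partial>?W) \<le> ennreal e * (\<integral>\<^sup>+M. f2 M \<partial>?W) + ennreal (exp (- t))"
    if [measurable]: "f1 \<in> borel_measurable borel" "f2 \<in> borel_measurable borel"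
      and line: "\<And>M. \<exists>h1 h2. h1 \<in> borel_measurable borel \<and> h2 \<in> borel_measurable borel \<and>
        (\<forall>z. f1 (M + z\<^sup>2 *\<^sub>R outer a) = h1 (z\<^sup>2)) \<and> (\<forall>z. f2 (M + z\<^sup>2 *\<^sub>R outer a) = h2 (z\<^sup>2)) \<and>
        (\<integral>\<^sup>+y. h1 y * ennreal (?\<gamma> y) \<partial>lborel) \<le> ennreal e * (\<integral>\<^sup>+y. h2 y * ennreal (?\<gamma> y) \<partial>lborel) +
          ennreal (exp (- t)) * (\<integral>\<^sup>+y. ennreal (?\<gamma> y) \<partial>lborel)"
    for f1 f2 :: "real^'d^'d \<Rightarrow> ennreal" and e :: real
  proof -
    \<comment> \<open>Folding the additive error into the integrand turns the claim into a single
      fibrewise inequality between integrals.\<close>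
    define F where "F M = ennreal e * f2 M + ennreal (exp (- t))" for M
    have [measurable]: "F \<in> borel_measurable borel" unfolding F_def[abs_def] by measurable
    have "(\<integral>\<^sup>+G. f1 (gram (G::real^'d^'d)) * ennreal (?w (gram G)) \<partial>lborel)
        \<le> (\<integral>\<^sup>+G. F (gram (G::real^'d^'d)) * ennreal (?w (gram G)) \<partial>lborel)"
    proof (rule nn_integral_gram_fibre_mono[where a = a and ?F1.0 = "\<lambda>M. f1 M * ennreal (?w M)" and ?F2.0 = "\<lambda>M. F M * ennreal (?w M)"])
      fix M c
      assume c: "0 \<le> c" and det: "\<And>z. det (M + z\<^sup>2 *\<^sub>R outer a) = c * z\<^sup>2"
      let ?A = "ennreal (sqrt c ^ j * exp (- (matrix_inv V \<bullet> M) / 2))"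
      obtain h1 h2 where [measurable]: "h1 \<in> borel_measurable borel" "h2 \<in> borel_measurable borel"
        and f1: "\<And>z. f1 (M + z\<^sup>2 *\<^sub>R outer a) = h1 (z\<^sup>2)" and f2: "\<And>z. f2 (M + z\<^sup>2 *\<^sub>R outer a) = h2 (z\<^sup>2)"
        and le: "(\<integral>\<^sup>+y. h1 y * ennreal (?\<gamma> y) \<partial>lborel) \<le> ennreal e * (\<integral>\<^sup>+y. h2 y * ennreal (?\<gamma> y) \<partial>lborel) +
          ennreal (exp (- t)) * (\<integral>\<^sup>+y. ennreal (?\<gamma> y) \<partial>lborel)"
        using line[of M] by blast
      have "(\<integral>\<^sup>+z. f1 (M + z\<^sup>2 *\<^sub>R outer a) * ennreal (?w (M + z\<^sup>2 *\<^sub>R outer a)) \<partial>lborel)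
         = ?A * (\<integral>\<^sup>+y. h1 y * ennreal (?\<gamma> y) \<partial>lborel)"
        unfolding f1 by (rule nn_integral_wishart_weight_fibre[OF _ c det]) measurable
      also have "\<dots> \<le> ?A * (ennreal e * (\<integral>\<^sup>+y. h2 y * ennreal (?\<gamma> y) \<partial>lborel) +
          ennreal (exp (- t)) * (\<integral>\<^sup>+y. ennreal (?\<gamma> y) \<partial>lborel))"
        by (rule mult_left_mono[OF le]) simp
      also have "\<dots> = ?A * (\<integral>\<^sup>+y. (ennreal e * h2 y + ennreal (exp (- t))) * ennreal (?\<gamma> y) \<partial>lborel)"
        by (simp add: distrib_right nn_integral_add nn_integral_cmult mult.assoc)
      also have "\<dots> = (\<integral>\<^sup>+z. (ennreal e * h2 (z\<^sup>2) + ennreal (exp (- t))) * ennreal (?w (M + z\<^sup>2 *\<^sub>R outer a)) \<partial>lborel)"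
        by (rule nn_integral_wishart_weight_fibre[OF _ c det, symmetric]) measurable
      finally show "(\<integral>\<^sup>+z. f1 (M + z\<^sup>2 *\<^sub>R outer a) * ennreal (?w (M + z\<^sup>2 *\<^sub>R outer a)) \<partial>lborel)
        \<le> (\<integral>\<^sup>+z. F (M + z\<^sup>2 *\<^sub>R outer a) * ennreal (?w (M + z\<^sup>2 *\<^sub>R outer a)) \<partial>lborel)"
        by (simp add: F_def f2)
    qed (use a in \<open>simp_all\<close>)
    then have "(\<integral>\<^sup>+M. f1 M \<partial>?W) \<le> (\<integral>\<^sup>+M. F M \<partial>?W)"
      by (simp add: \<kappa> mult_left_mono)
    also have "\<dots> = ennreal e * (\<integral>\<^sup>+M. f2 M \<partial>?W) + ennreal (exp (- t))"
      unfolding F_def by (simp add: nn_integral_add nn_integral_cmult emeasure_space_1)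
    finally show ?thesis .
  qed
  have shift[measurable]: "{M. M + outer a \<in> S} \<in> sets borel"
    using measurable_sets[of "\<lambda>M. M + outer a" borel borel S] by (simp add: vimage_def)
  let ?h = "\<lambda>M y. indicator S (M + y *\<^sub>R outer a) :: ennreal"
  have h: "?h M \<in> borel_measurable borel" "?h M y \<le> 1" "(\<lambda>y. ?h M (y + 1)) \<in> borel_measurable borel" for M y
    by (auto simp: indicator_def)
  have i1: "indicator {M. M + outer a \<in> S} (M + z\<^sup>2 *\<^sub>R outer a) = ?h M (z\<^sup>2 + 1)" for M z
    by (simp add: indicator_def algebra_simps)
  have "(\<integral>\<^sup>+M. indicator {M. M + outer a \<in> S} M \<partial>?W) \<le> ennreal (exp (11 / 20 * \<epsilon>)) * (\<integral>\<^sup>+M. indicator S M \<partial>?W) + ennreal (exp (- t))"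
    by (rule main) (use gamma_shift_dp(1)[OF h(1,2) p u \<epsilon> k t] h i1 in \<open>measurable, fast\<close>)
  then show ?A by simp
  have "(\<integral>\<^sup>+M. indicator S M \<partial>?W) \<le> ennreal (exp (9 / 20 * \<epsilon>)) * (\<integral>\<^sup>+M. indicator {M. M + outer a \<in> S} M \<partial>?W) + ennreal (exp (- t))"
    by (rule main) (use gamma_shift_dp(2)[OF h(1,2) p u \<epsilon> k t] h i1 in \<open>measurable, fast\<close>)
  then show ?B by simp
qed

section \<open>From rank-one shifts to neighbouring inputs\<close>

lemma matrix_mult_matrix_inv:
  assumes "pos_def_mat (V :: real^'d^'d)"
  shows "V ** matrix_inv V = mat 1"
proof -
  have "invertible V" using pos_def_mat_det_pos[OF assms] by (simp add: invertible_det_nz)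
  then obtain W where "V ** W = mat 1" by (auto simp: invertible_def)
  then show ?thesis using matrix_inv_unique by metis
qed

text \<open>Put \<open>x = matrix_inv V *v a\<close>. Then \<open>a \<bullet> x\<close> equals
  \<open>(V *v x) \<bullet> x\<close>, which is positive, and \<open>norm a = norm (V *v x)\<close>
  is at least \<open>C * norm x\<close>; Cauchy-Schwarz gives the upper bound.\<close>

lemma inner_matrix_inv_bounds:
  fixes V :: "real^'d^'d"
  assumes V: "pos_def_mat V" and C: "0 < C" "C \<le> least_singular_value V" and a: "a \<noteq> 0"
  shows "0 < a \<bullet> (matrix_inv V *v a)" "a \<bullet> (matrix_inv V *v a) \<le> (norm a)\<^sup>2 / C"
proof -
  define x where "x = matrix_inv V *v a"
  have Vx: "V *v x = a"
    by (simp add: x_def matrix_vector_mul_assoc matrix_mult_matrix_inv[OF V])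
  then have x: "x \<noteq> 0" using a by auto
  show "0 < a \<bullet> (matrix_inv V *v a)"
    using V x Vx unfolding x_def[symmetric] pos_def_mat_def by (metis inner_commute)
  have "C \<le> norm (V *v (x /\<^sub>R norm x))"
  proof -
    have "Inf {norm (V *v x) | x. norm x = 1} \<le> norm (V *v (x /\<^sub>R norm x))"
      by (rule cInf_lower) (use x in \<open>auto intro!: exI[of _ "x /\<^sub>R norm x"] bdd_belowI[of _ 0]\<close>)
    then show ?thesis using C(2) by (simp add: least_singular_value_def)
  qed
  also have "\<dots> = norm a / norm x"
    by (simp add: matrix_vector_mult_scaleR Vx divide_inverse mult.commute)
  finally have "norm x \<le> norm a / C" using x C(1) by (simp add: field_simps)
  have "a \<bullet> x \<le> norm a * norm x" by (rule norm_cauchy_schwarz)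
  also have "\<dots> \<le> norm a * (norm a / C)"
    by (rule mult_left_mono) (use \<open>norm x \<le> norm a / C\<close> in auto)
  finally show "a \<bullet> (matrix_inv V *v a) \<le> (norm a)\<^sup>2 / C"
    by (simp add: x_def power2_eq_square)
qed

lemma gram_neighbors:
  assumes "neighbors A A'"
  obtains i H where "gram A = H + outer (A $ i)" "gram A' = H + outer (A' $ i)"
proof -
  obtain i where i: "{i. A $ i \<noteq> A' $ i} = {i}"
    using assms by (auto simp: neighbors_def card_1_singleton_iff)
  show thesis
  proof
    show "gram A = (\<Sum>k\<in>UNIV - {i}. outer (A $ k)) + outer (A $ i)"
      unfolding gram_eq_sum_outer by (subst sum.remove[of UNIV i]) (auto simp: add.commute)
    have "(\<Sum>k\<in>UNIV - {i}. outer (A $ k)) = (\<Sum>k\<in>UNIV - {i}. outer (A' $ k))"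
    proof (rule sum.cong)
      fix k assume "k \<in> UNIV - {i}"
      then have "A $ k = A' $ k" using i by blast
      then show "outer (A $ k) = outer (A' $ k)" by simp
    qed simp
    then show "gram A' = (\<Sum>k\<in>UNIV - {i}. outer (A $ k)) + outer (A' $ i)"
      unfolding gram_eq_sum_outer by (subst sum.remove[of UNIV i]) (auto simp: add.commute)
  qed
qed

theorem theoremB3:
  fixes \<epsilon> \<delta> B C1 C2 :: real and V :: "real^'d^'d" and \<nu> :: nat
  assumes "0 < \<epsilon>" "\<epsilon> < 1" "0 < \<delta>" "\<delta> < 1 / exp 1" "0 < B"
    and "0 < C1" "1 < C2"
    and "2 * sqrt C2 / (C1 * (sqrt C2 - 1)^2) \<le> \<epsilon> / B^2"
    and "pos_def_mat V" "least_singular_value V \<ge> C1"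
    and "real \<nu> \<ge> of_int \<lfloor>real CARD('d) + 2 * C2 * ln (4 / \<delta>)\<rfloor>"
  shows "diff_private B \<epsilon> \<delta> (wishart_mech V \<nu> :: real^'d^'n \<Rightarrow> _) borel"
proof -
  define t where "t = ln (4 / \<delta>)"
  have exp_t: "exp (- t) = \<delta> / 4"
    using \<open>0 < \<delta>\<close> by (simp add: t_def exp_minus)
  \<comment> \<open>From \<open>\<delta> < 1 / exp 1\<close>, \<open>t\<close> exceeds
    \<open>2 * ln 2 + 1\<close>, which is at least \<open>7 / 3\<close>.\<close>
  have t: "9 / 4 \<le> t"
  proof -
    have "exp 1 < 1 / \<delta>" using assms(3,4) by (simp add: field_simps)
    then have "1 < ln (1 / \<delta>)" using \<open>0 < \<delta>\<close> by (metis exp_less_cancel_iff exp_ln zero_less_divide_1_iff)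
    moreover have "t = ln (2 * 2) + ln (1 / \<delta>)" using \<open>0 < \<delta>\<close> ln_mult[of "2 * 2" "1 / \<delta>"] by (simp add: t_def)
    moreover have "ln (2 * 2 :: real) = ln 2 + ln 2" using ln_mult[of 2 "2::real"] by simp
    ultimately show ?thesis using ln2_ge_two_thirds by simp
  qed
  have x0: "0 \<le> 2 * C2 * t" using t assms(7) by simp
  define j where "j = \<nu> - CARD('d)"
  have "of_int \<lfloor>real CARD('d) + 2 * C2 * t\<rfloor> = real CARD('d) + of_int \<lfloor>2 * C2 * t\<rfloor>"
    using floor_add_int[of "2 * C2 * t" "int CARD('d)"] by (simp add: add.commute)
  then have \<nu>_ge: "real CARD('d) + of_int \<lfloor>2 * C2 * t\<rfloor> \<le> real \<nu>"
    using assms(11) by (simp add: t_def)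
  moreover have "0 \<le> \<lfloor>2 * C2 * t\<rfloor>" using x0 by simp
  ultimately have "real CARD('d) \<le> real \<nu>" by linarith
  then have \<nu>: "\<nu> = CARD('d) + j" by (simp add: j_def)
  \<comment> \<open>The floor loses less than one; the chi-square variable has \<open>Suc j\<close>
    rather than \<open>j\<close> degrees of freedom, which makes up for it.\<close>
  have j: "2 * C2 * t \<le> real (Suc j)" using \<nu>_ge unfolding \<nu> by simp linarith
  \<comment> \<open>With this choice the hypothesis on \<open>C1\<close> and \<open>C2\<close>
    becomes exactly the ratio condition of the one-dimensional estimate at
    \<open>p = B^2 / C1\<close>.\<close>
  define u where "u = 1 / sqrt C2"
  have u: "0 < u" "u < 1" using assms(7) by (auto simp: u_def)
  have k: "2 * t \<le> real (Suc j) * u\<^sup>2"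
    using j assms(7) by (simp add: u_def power_divide field_simps)
  have up: "2 * u * p / (1 - u)\<^sup>2 \<le> \<epsilon>" if "p \<le> B\<^sup>2 / C1" for p
  proof -
    define r where "r = sqrt C2"
    have r: "1 < r" using assms(7) by (simp add: r_def)
    have "2 * u / (1 - u)\<^sup>2 = 2 * r / (r - 1)\<^sup>2"
    proof -
      have "1 - u = (r - 1) / r" using r by (simp add: u_def r_def[symmetric] field_simps)
      then have "2 * u / (1 - u)\<^sup>2 = 2 * (1 / r) / ((r - 1)\<^sup>2 / r\<^sup>2)" by (simp add: u_def r_def[symmetric] power_divide)
      also have "\<dots> = 2 * r / (r - 1)\<^sup>2" using r by (simp add: power2_eq_square)
      finally show ?thesis .
    qed
    moreover have "2 * u * p / (1 - u)\<^sup>2 = 2 * u / (1 - u)\<^sup>2 * p" by simp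
    ultimately have "2 * u * p / (1 - u)\<^sup>2 = 2 * r / (r - 1)\<^sup>2 * p" by (simp only:)
    also have "\<dots> \<le> 2 * r / (r - 1)\<^sup>2 * (B\<^sup>2 / C1)" using that r by (intro mult_left_mono) auto
    also have "\<dots> = 2 * r / (C1 * (r - 1)\<^sup>2) * B\<^sup>2" by simp
    also have "\<dots> \<le> \<epsilon> / B\<^sup>2 * B\<^sup>2" using assms(8) by (intro mult_right_mono) (auto simp: r_def)
    also have "\<dots> = \<epsilon>" using assms(5) by simp
    finally show ?thesis .
  qed
  interpret W: prob_space "wishart V \<nu>" using assms(9) by (rule prob_space_wishart)
  let ?P = "measure (wishart V \<nu>)"
  have step: "?P {M. M + outer a \<in> S} \<le> exp (11 / 20 * \<epsilon>) * ?P S + \<delta> / 4 \<and>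
      ?P S \<le> exp (9 / 20 * \<epsilon>) * ?P {M. M + outer a \<in> S} + \<delta> / 4"
    if S: "S \<in> sets borel" and a: "norm a \<le> B" for S and a :: "real^'d"
  \<comment> \<open>A zero row has no direction to fibre along, but it does not move the
    distribution either.\<close>
  proof (cases "a = 0")
    case True
    have "outer a = 0" using True by (simp add: outer_def vec_eq_iff)
    moreover have "1 * ?P S \<le> exp (11 / 20 * \<epsilon>) * ?P S" "1 * ?P S \<le> exp (9 / 20 * \<epsilon>) * ?P S"
      using assms(1) by (intro mult_right_mono; simp)+
    ultimately show ?thesis using assms(3) by simp
  next
    case False
    have "(norm a)\<^sup>2 / C1 \<le> B\<^sup>2 / C1"
      using a assms(6) by (intro divide_right_mono power_mono) auto
    then have "a \<bullet> (matrix_inv V *v a) \<le> B\<^sup>2 / C1"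
      using inner_matrix_inv_bounds(2)[OF assms(9,6,10) False] by linarith
    note dp = wishart_shift_dp[OF assms(9) S False inner_matrix_inv_bounds(1)[OF assms(9,6,10) False] u up[OF this] assms(2) k t]
    have le: "x \<le> e * y + exp (- t)" if "ennreal x \<le> ennreal e * ennreal y + ennreal (exp (- t))" "0 \<le> e" "0 \<le> y" for x y e :: real
      using that by (simp add: ennreal_mult[symmetric] ennreal_plus[symmetric] del: ennreal_plus)
    have "?P {M. M + outer a \<in> S} \<le> exp (11 / 20 * \<epsilon>) * ?P S + exp (- t)"
      by (rule le) (use dp(1) in \<open>simp_all only: \<nu>[symmetric] W.emeasure_eq_measure exp_ge_zero measure_nonneg\<close>)
    moreover have "?P S \<le> exp (9 / 20 * \<epsilon>) * ?P {M. M + outer a \<in> S} + exp (- t)"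
      by (rule le) (use dp(2) in \<open>simp_all only: \<nu>[symmetric] W.emeasure_eq_measure exp_ge_zero measure_nonneg\<close>)
    ultimately show ?thesis by (simp only: exp_t)
  qed
  show ?thesis
    unfolding diff_private_def
  proof (intro allI impI ballI)
    fix A A' :: "real^'d^'n" and S :: "(real^'d^'d) set"
    assume A: "\<forall>i. norm (A $ i) \<le> B" and A': "\<forall>i. norm (A' $ i) \<le> B" and "neighbors A A'" and S: "S \<in> sets borel"
    then obtain i H where H: "gram A = H + outer (A $ i)" "gram A' = H + outer (A' $ i)"
      using gram_neighbors by metis
    \<comment> \<open>Translating the event by the contribution \<open>H\<close> of the common rows
      leaves only the rank-one shifts of the changed row.\<close>
    define S' where "S' = {M. H + M \<in> S}"
    have S': "S' \<in> sets borel"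
      using measurable_sets[of "\<lambda>M. H + M" borel borel S] S by (simp add: S'_def vimage_def)
    have mech: "measure (wishart_mech V \<nu> X) S = ?P {M. M + outer a \<in> S'}"
      if "gram X = H + outer a" for X :: "real^'d^'n" and a
    proof -
      have "measure (wishart_mech V \<nu> X) S = ?P ((\<lambda>N. transpose X ** X + N) -` S \<inter> space (wishart V \<nu>))"
        unfolding wishart_mech_def by (rule measure_distr) (use S in auto)
      also have "(\<lambda>N. transpose X ** X + N) -` S \<inter> space (wishart V \<nu>) = {M. M + outer a \<in> S'}"
        using that by (auto simp: gram_def S'_def wishart_def add_ac)
      finally show ?thesis .
    qed
    let ?e1 = "exp (11 / 20 * \<epsilon>)" and ?e2 = "exp (9 / 20 * \<epsilon>)"
    have "?P {M. M + outer (A $ i) \<in> S'} \<le> ?e1 * ?P S' + \<delta> / 4"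
      using step[OF S'] A by blast
    \<comment> \<open>The intermediate quantity \<open>?P S'\<close> belongs to the input without
      the changed row: the row of \<open>A\<close> is removed first, then the row of
      \<open>A'\<close> is added.\<close>
    also have "\<dots> \<le> ?e1 * (?e2 * ?P {M. M + outer (A' $ i) \<in> S'} + \<delta> / 4) + \<delta> / 4"
      using step[OF S', of "A' $ i"] A' by (intro add_right_mono mult_left_mono) auto
    also have "\<dots> = (?e1 * ?e2) * ?P {M. M + outer (A' $ i) \<in> S'} + (?e1 + 1) * (\<delta> / 4)"
      by (simp add: algebra_simps)
    also have "\<dots> \<le> exp \<epsilon> * ?P {M. M + outer (A' $ i) \<in> S'} + \<delta>"
    proof -
      have "?e1 * ?e2 = exp \<epsilon>" by (simp add: exp_add[symmetric])
      moreover have "?e1 \<le> exp 1" using assms(2) by simp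
      \<comment> \<open>The error of the second step is multiplied by \<open>?e1\<close>, which is
        at most \<open>exp 1\<close> and hence at most \<open>3\<close>; this accounts for the
        \<open>4\<close> in \<open>ln (4 / \<delta>)\<close>.\<close>
      moreover have "(?e1 + 1) * (\<delta> / 4) \<le> 4 * (\<delta> / 4)"
      proof (rule mult_right_mono)
        show "?e1 + 1 \<le> 4" using \<open>?e1 \<le> exp 1\<close> exp_le by linarith
      qed (use assms(3) in simp)
      ultimately show ?thesis by simp
    qed
    finally show "measure (wishart_mech V \<nu> A) S \<le> exp \<epsilon> * measure (wishart_mech V \<nu> A') S + \<delta>"
      using H by (simp add: mech)
  qed
qed

end
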